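(* Let $\Sigma=\{\alpha_1,\alpha_2,\dots\}$ be an infinite countable alphabet, $\upsilon\notin\Sigma$ a variable, $\vec k=(k_n)_{n\in\mathbb N}\subseteq\mathbb N$ an increasing sequence, $\mathcal U\subseteq L^\infty(\Sigma,\vec k;\upsilon)$, $\mathbf t\in L^{<\infty}(\Sigma,\vec k;\upsilon)$ and $\vec w\in L^\infty(\Sigma,\vec k;\upsilon)$. Then either there exists $\vec u\prec\vec w$ such that $[\mathbf t,\vec u]\subseteq\hat{\mathcal U}$, or there exists a countable ordinal $\xi_0$ such that for every countable $\xi>\xi_0$ there exists $\vec u\prec\vec w-\mathbf t$ with $[\mathbf t\odot\mathbf s,\vec u]\subseteq L^\infty(\Sigma,\vec k;\upsilon)\setminus\mathcal U$ for every $\mathbf s\in L^\xi(\Sigma,\vec k;\upsilon)\cap EV^{<\infty}(\vec u)$.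
   Context: $\mathbb N=\{1,2,\dots\}$. $L(\Sigma,\vec k;\upsilon)$: functions $w$ from a nonempty finite $\mathrm{dom}(w)\subseteq\mathbb N$ into $\Sigma\cup\{\upsilon\}$ with $w(n)\in\{\upsilon,\alpha_1,\dots,\alpha_{k_n}\}$ and $\upsilon$ attained. $w<u$ iff $\max\mathrm{dom}(w)<\min\mathrm{dom}(u)$; then $w\star u$ is the word on $\mathrm{dom}(w)\cup\mathrm{dom}(u)$ agreeing with $w,u$. $T_0(w)=w$; for $p\in\mathbb N$, $T_p(w)$ replaces each $\upsilon$ at position $n$ by $\alpha_{\min(p,k_n)}$. $L^\infty(\Sigma,\vec k;\upsilon)$: sequences $(w_n)$ with $w_n<w_{n+1}$; $EV(\vec w)$: words $T_{p_1}(w_{n_1})\star\cdots\star T_{p_\lambda}(w_{n_\lambda})$, $n_1<\dots<n_\lambda$, integers $0\le p_i\le k_{n_i}$, some $p_i=0$; $\vec u\prec\vec w$ iff $\vec u\in L^\infty$ with all terms in $EV(\vec w)$. $L^{<\infty}(\Sigma,\vec k;\upsilon)$: $\emptyset$ and tuples $(w_1,\dots,w_l)$ with $w_1<\dots<w_l$; $EV^{<\infty}(\vec u)$: $\emptyset$ and such tuples with terms in $EV(\vec u)$. $\mathbf t\propto\vec w$ means $\mathbf t$ is an initial segment of $\vec w$. For $\mathbf t=(t_1,\dots,t_k)$ nonempty, $\vec w-\mathbf t=(w_n)_{n\ge l}$ with $l=\min\{n:t_k<w_n\}$, and $\vec w-\emptyset=\vec w$. For $\mathbf t=(t_1,\dots,t_k)$,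 $\mathbf s=(s_1,\dots,s_l)$ with $t_k<s_1$, $\mathbf t\odot\mathbf s=(t_1,\dots,t_k,s_1,\dots,s_l)$ (with $\emptyset\odot\mathbf s=\mathbf s$, $\mathbf t\odot\emptyset=\mathbf t$). Topology $\mathfrak T_E$ on $L^\infty(\Sigma,\vec k;\upsilon)$: basic open sets $[\mathbf t,\vec s]=\{\vec w\in L^\infty:\mathbf t\propto\vec w,\ \vec w-\mathbf t\prec\vec s\}$, $\mathbf t\in L^{<\infty}$, $\vec s\in L^\infty$; $\hat{\mathcal U}$ denotes the $\mathfrak T_E$-closure of $\mathcal U$. Schreier families $\mathcal A_\xi$: fixing for each nonzero countable limit $\lambda$ an increasing sequence of successor ordinals $\lambda_n\uparrow\lambda$, and with $s_1<s_2$ meaning $\max s_1<\min s_2$: $\mathcal A_0=\{\emptyset\}$, $\mathcal A_1=\{\{n\}\}$, $\mathcal A_{\zeta+1}=\{\{n\}\cup s_1:\{n\}<s_1\in\mathcal A_\zeta\}$, $\mathcal A_{\omega^{\beta+1}}=\{s_1\cup\dots\cup s_n:n=\min s_1,\ s_1<\dots<s_n\in\mathcal A_{\omega^\beta}\}$, $\mathcal A_{\omega^\lambda}=\{s\ne\emptyset:s\in\mathcal A_{\omega^{\lambda_{\min s}}}\}$ for limit $\lambda$, and for limit $\xi=\omega^\alpha p+\sum_{i=1}^m\omega^{a_i}p_i$ with $\omega^\alpha<\xi<\omega^{\alpha+1}$, $\alpha>a_1>\dots>a_m>0$: sets $s_0\cup\bigcup_i s_i$ with $s_m<\dots<s_1<s_0$,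 $s_0$ a union of $p$ successive sets of $\mathcal A_{\omega^\alpha}$, $s_i$ a union of $p_i$ successive sets of $\mathcal A_{\omega^{a_i}}$. For $\xi\ge1$, $L^\xi(\Sigma,\vec k;\upsilon)=\{(w_1,\dots,w_l)\in L^{<\infty}:\{\min\mathrm{dom}(w_i)\}_{i\le l}\in\mathcal A_\xi\}$, $L^0=\{\emptyset\}$. *)

theory Defs
  imports "HOL-Analysis.Abstract_Topology"
begin

text \<open>The countable ordinals are the elements of the first uncountable ordinal, which the library
  provides as the well-order \<open>cardSuc natLeq\<close>.\<close>

typedef omega1 = "Field (cardSuc natLeq)"
proof -
  have "infinite (Field (cardSuc natLeq))"
    using cardSuc_finite[OF natLeq_Card_order] by (simp add: Field_natLeq)
  thus ?thesis by (metis ex_in_conv finite.emptyI)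
qed

lemma cardSuc_natLeq_Well_order: "Well_order (cardSuc natLeq)"
  using cardSuc_Card_order[OF natLeq_Card_order] by (simp add: card_order_on_def)

instantiation omega1 :: wellorder
begin

definition less_eq_omega1 :: "omega1 \<Rightarrow> omega1 \<Rightarrow> bool"
  where "a \<le> b \<longleftrightarrow> (Rep_omega1 a, Rep_omega1 b) \<in> cardSuc natLeq"

definition less_omega1 :: "omega1 \<Rightarrow> omega1 \<Rightarrow> bool"
  where "a < b \<longleftrightarrow> a \<le> b \<and> a \<noteq> b" for a b :: omega1

instance
proof -
  note wo = cardSuc_natLeq_Well_order[unfolded well_order_on_def linear_order_on_def
      partial_order_on_def preorder_on_def]
  have refl: "a \<le> a" for a :: omega1
    using wo Rep_omega1[of a] by (auto simp: less_eq_omega1_def refl_on_def)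
  have trans: "a \<le> c" if "a \<le> b" "b \<le> c" for a b c :: omega1
    using wo that by (auto simp: less_eq_omega1_def elim: transE)
  have antisym: "a = b" if "a \<le> b" "b \<le> a" for a b :: omega1
    using wo that by (auto simp: less_eq_omega1_def Rep_omega1_inject dest: antisymD)
  have total: "a \<le> b \<or> b \<le> a" for a b :: omega1
    using wo Rep_omega1[of a] Rep_omega1[of b] refl
    by (cases "a = b") (auto simp: less_eq_omega1_def total_on_def Rep_omega1_inject)
  have wf: "wf {(a, b :: omega1). a < b}"
  proof (rule wf_subset)
    show "wf (inv_image (cardSuc natLeq - Id) Rep_omega1)"
      using wo by (intro wf_inv_image) blast
  qed (auto simp: less_omega1_def less_eq_omega1_def Rep_omega1_inject)
  show "OFCLASS(omega1, wellorder_class)"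
  proof
    fix a b c :: omega1 and P
    show "a < b \<longleftrightarrow> a \<le> b \<and> \<not> b \<le> a"
      unfolding less_omega1_def using antisym refl by blast
    show "P a" if "\<And>x. (\<And>y. y < x \<Longrightarrow> P y) \<Longrightarrow> P x"
      using wf_induct_rule[OF wf, of P a] that by blast
  qed (fact refl trans antisym total | (erule (1) trans antisym))+
qed

end

context
  includes cardinal_syntax
begin

lemma countable_lessThan_omega1: "countable {..<a :: omega1}"
proof -
  let ?r = "cardSuc natLeq"
  have "|underS ?r (Rep_omega1 a)| <o ?r"
    using cardSuc_Card_order[OF natLeq_Card_order] Rep_omega1 by (rule card_of_underS)
  hence "|underS ?r (Rep_omega1 a)| \<le>o natLeq"
    using cardSuc_ordLeq_ordLess[OF natLeq_Card_order card_of_Card_order] by blast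
  hence "|underS ?r (Rep_omega1 a)| \<le>o |(UNIV :: nat set)|"
    using card_of_nat ordIso_iff_ordLeq ordLeq_transitive by blast
  hence "countable (underS ?r (Rep_omega1 a))"
    unfolding countable_def using card_of_ordLeq[of "underS ?r (Rep_omega1 a)" "UNIV :: nat set"]
    by auto
  moreover have "Rep_omega1 ` {..<a} \<subseteq> underS ?r (Rep_omega1 a)"
    by (auto simp: underS_def less_omega1_def less_eq_omega1_def Rep_omega1_inject)
  ultimately show ?thesis
    by (meson countable_image_inj_on countable_subset Rep_omega1_inject inj_onI)
qed

lemma uncountable_omega1: "uncountable (UNIV :: omega1 set)"
proof
  assume "countable (UNIV :: omega1 set)"
  hence "countable (Field (cardSuc natLeq))"
    using type_definition.Rep_range[OF type_definition_omega1] by (metis countable_image)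
  hence "|Field (cardSuc natLeq)| \<le>o |(UNIV :: nat set)|"
    unfolding countable_def by (metis card_of_ordLeqI UNIV_I)
  hence "cardSuc natLeq \<le>o natLeq"
    using card_of_Field_ordIso[OF cardSuc_Card_order[OF natLeq_Card_order]] card_of_nat
    by (meson ordIso_iff_ordLeq ordLeq_transitive)
  thus False
    using cardSuc_greater[OF natLeq_Card_order] not_ordLess_ordLeq by blast
qed

end

text \<open>Every countable set of countable ordinals has a countable strict upper bound, so that every
  \<open>LEAST\<close> in the definitions of ordinal arithmetic below is attained.\<close>

lemma countable_omega1_bounded:
  assumes "countable (A :: omega1 set)"
  shows "\<exists>b. \<forall>a\<in>A. a < b"
proof (rule ccontr)
  assume "\<not> ?thesis"
  hence "(UNIV :: omega1 set) = (\<Union>a\<in>A. insert a {..<a})"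
    by (auto simp: not_less) (metis order.order_iff_strict)
  moreover have "countable (\<Union>a\<in>A. insert a {..<a})"
    using assms countable_lessThan_omega1 by auto
  ultimately show False using uncountable_omega1 by simp
qed

definition osuc :: "omega1 \<Rightarrow> omega1"
  where "osuc a = (LEAST b. a < b)"

instantiation omega1 :: zero_neq_one
begin

definition zero_omega1 :: omega1 where "0 = (LEAST a :: omega1. True)"

definition one_omega1 :: omega1 where "1 = osuc 0"

instance
proof
  obtain b :: omega1 where "0 < b"
    using countable_omega1_bounded[of "{0}"] by auto
  hence "(0::omega1) < osuc 0"
    unfolding osuc_def by (rule LeastI)
  thus "(0::omega1) \<noteq> 1" by (simp add: one_omega1_def)
qed

end

definition is_limit :: "omega1 \<Rightarrow> bool"
  where "is_limit a \<longleftrightarrow> a \<noteq> 0 \<and> (\<nexists>b. a = osuc b)"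

text \<open>\<open>oadd a b = sup ({a} \<union> {osuc (oadd a b') | b' < b})\<close>\<close>

function oadd :: "omega1 \<Rightarrow> omega1 \<Rightarrow> omega1"
  where "oadd a b = (LEAST c. a \<le> c \<and> (\<forall>b'\<in>{..<b}. oadd a b' < c))"
  by pat_completeness auto
termination
  by (relation "inv_image {(x, y). x < y} snd") (auto intro: wf)

declare oadd.simps [simp del]

text \<open>\<open>omul_nat a n\<close> is the ordinal product of \<open>a\<close> and the natural number \<open>n\<close>, in this order:
  \<open>a + \<dots> + a\<close> with \<open>n\<close> summands.\<close>

primrec omul_nat :: "omega1 \<Rightarrow> nat \<Rightarrow> omega1" where
  "omul_nat a 0 = 0"
| "omul_nat a (Suc n) = oadd (omul_nat a n) a"

text \<open>The ordinal power \<open>\<omega>\<^sup>b = sup ({1} \<union> {\<omega>\<^sup>b\<^sup>' \<cdot> n | b' < b, n < \<omega>})\<close>, which combines the clauses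
  \<open>1\<close> for \<open>b = 0\<close>, \<open>\<omega>\<^sup>b\<^sup>' \<cdot> \<omega>\<close> for \<open>b = b' + 1\<close>, and the supremum of the \<open>\<omega>\<^sup>b\<^sup>'\<close> for limit \<open>b\<close>.\<close>

function omega_pow :: "omega1 \<Rightarrow> omega1"
  where "omega_pow b = (LEAST c. 1 \<le> c \<and> (\<forall>b'\<in>{..<b}. \<forall>n. omul_nat (omega_pow b') n \<le> c))"
  by pat_completeness auto
termination
  by (relation "{(x, y). x < y}") (auto intro: wf)

declare omega_pow.simps [simp del]

text \<open>\<open>omega_sum [(a\<^sub>0, p\<^sub>0), \<dots>, (a\<^sub>m, p\<^sub>m)] = \<omega>\<^bsup>a\<^sub>0\<^esup> p\<^sub>0 + \<dots> + \<omega>\<^bsup>a\<^sub>m\<^esup> p\<^sub>m\<close>\<close>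

primrec omega_sum :: "(omega1 \<times> nat) list \<Rightarrow> omega1" where
  "omega_sum [] = 0"
| "omega_sum (t # ts) = oadd (omul_nat (omega_pow (fst t)) (snd t)) (omega_sum ts)"

text \<open>\<open>lam \<lambda> n\<close>, for \<open>n \<ge> 1\<close>, is the \<open>n\<close>-th term of the sequence fixed for the limit ordinal \<open>\<lambda>\<close>;
  nondecreasing sequences are admitted along with strictly increasing ones.\<close>

definition fundamental_sequences :: "(omega1 \<Rightarrow> nat \<Rightarrow> omega1) \<Rightarrow> bool" where
  "fundamental_sequences lam \<longleftrightarrow>
     (\<forall>l. is_limit l \<longrightarrow>
        (\<forall>n\<ge>1. lam l n < l \<and> (\<exists>b. lam l n = osuc b)) \<and>
        mono_on {1..} (lam l) \<and>
        (\<forall>a<l. \<exists>n\<ge>1. a < lam l n))"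

text \<open>\<open>max s < min t\<close>, vacuously true if \<open>s\<close> or \<open>t\<close> is empty, as needed for the successor clause
  of the Schreier families at the predecessor \<open>0\<close>.\<close>

definition before :: "nat set \<Rightarrow> nat set \<Rightarrow> bool"
  where "before s t \<longleftrightarrow> (\<forall>m\<in>s. \<forall>n\<in>t. m < n)"

definition union_of_successive :: "nat \<Rightarrow> (nat set \<Rightarrow> bool) \<Rightarrow> nat set \<Rightarrow> bool" where
  "union_of_successive p F s \<longleftrightarrow>
     (\<exists>ss. length ss = p \<and> sorted_wrt before ss \<and> (\<forall>x\<in>set ss. F x) \<and> s = \<Union>(set ss))"

lemma union_of_successive_mono [mono]:
  "F \<le> G \<Longrightarrow> union_of_successive p F s \<longrightarrow> union_of_successive p G s"
  unfolding union_of_successive_def by (metis predicate1D)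

text \<open>\<open>schreier lam \<xi> s\<close> means \<open>s \<in> \<A>\<^sub>\<xi>\<close>.  Every \<open>\<xi>\<close> falls under exactly one clause (except that
  \<open>succ\<close> with \<open>\<zeta> = 0\<close> repeats \<open>one\<close>), and premises only refer to smaller ordinals, so the least fixed
  point is the family defined by transfinite recursion.  In \<open>sum\<close>, \<open>ts\<close> lists the pairs
  \<open>(\<alpha>, p), (a\<^sub>1, p\<^sub>1), \<dots>, (a\<^sub>m, p\<^sub>m)\<close> and \<open>ss\<close> the sets \<open>s\<^sub>0, s\<^sub>1, \<dots>, s\<^sub>m\<close>, where \<open>m = 0\<close> is allowed
  (the case \<open>\<xi> = \<omega>\<^sup>\<alpha> p\<close>); the sets occur on the line in the reverse order.\<close>

inductive schreier :: "(omega1 \<Rightarrow> nat \<Rightarrow> omega1) \<Rightarrow> omega1 \<Rightarrow> nat set \<Rightarrow> bool"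
  for lam :: "omega1 \<Rightarrow> nat \<Rightarrow> omega1" where
  zero: "schreier lam 0 {}"
| one: "1 \<le> n \<Longrightarrow> schreier lam 1 {n}"
| succ: "\<lbrakk>1 \<le> n; before {n} s; schreier lam \<zeta> s\<rbrakk> \<Longrightarrow> schreier lam (osuc \<zeta>) ({n} \<union> s)"
| pow_succ: "\<lbrakk>s \<noteq> {}; union_of_successive (Min s) (schreier lam (omega_pow \<beta>)) s\<rbrakk>
    \<Longrightarrow> schreier lam (omega_pow (osuc \<beta>)) s"
| pow_limit: "\<lbrakk>is_limit l; s \<noteq> {}; schreier lam (omega_pow (lam l (Min s))) s\<rbrakk>
    \<Longrightarrow> schreier lam (omega_pow l) s"
| sum: "\<lbrakk>is_limit \<xi>; ts = (\<alpha>, p) # ts'; \<xi> = omega_sum ts;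
      omega_pow \<alpha> < \<xi>; \<xi> < omega_pow (osuc \<alpha>);
      sorted_wrt (>) (map fst ts); \<forall>(a, q)\<in>set ts. 0 < a \<and> 0 < q;
      length ss = length ts; sorted_wrt (\<lambda>x y. before y x) ss;
      \<forall>i<length ts. union_of_successive (snd (ts ! i)) (schreier lam (omega_pow (fst (ts ! i)))) (ss ! i);
      s = \<Union>(set ss)\<rbrakk>
    \<Longrightarrow> schreier lam \<xi> s"

text \<open>The alphabet is \<open>{\<alpha> 1, \<alpha> 2, \<dots>}\<close> and the variable is \<open>\<upsilon>\<close>.  A word is a partial function on
  \<open>nat\<close> whose (finite) domain does not contain \<open>0\<close>.  The values \<open>\<alpha> 0\<close> and \<open>k 0\<close> are never used.

  An infinite sequence \<open>(w\<^sub>1, w\<^sub>2, \<dots>)\<close> of words is represented by the function \<open>w\<close> on \<open>nat\<close>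
  with \<open>w i = w\<^bsub>i+1\<^esub>\<close>, so that equal sequences are equal functions; the bound
  \<open>k\<^sub>n\<close> belonging to the term \<open>w\<^sub>n\<close> therefore appears as \<open>k (Suc i)\<close>.\<close>

type_synonym 'a word = "nat \<rightharpoonup> 'a"

definition L :: "(nat \<Rightarrow> 'a) \<Rightarrow> 'a \<Rightarrow> (nat \<Rightarrow> nat) \<Rightarrow> 'a word set" where
  "L \<alpha> \<upsilon> k = {w. finite (dom w) \<and> dom w \<noteq> {} \<and> 0 \<notin> dom w \<and>
     (\<forall>n\<in>dom w. the (w n) \<in> {\<upsilon>} \<union> \<alpha> ` {1..k n}) \<and> \<upsilon> \<in> ran w}"

definition word_less :: "'a word \<Rightarrow> 'a word \<Rightarrow> bool"
  where "word_less w u \<longleftrightarrow> Max (dom w) < Min (dom u)"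

definition T :: "(nat \<Rightarrow> 'a) \<Rightarrow> 'a \<Rightarrow> (nat \<Rightarrow> nat) \<Rightarrow> nat \<Rightarrow> 'a word \<Rightarrow> 'a word" where
  "T \<alpha> \<upsilon> k p w =
     (if p = 0 then w else (\<lambda>n. if w n = Some \<upsilon> then Some (\<alpha> (min p (k n))) else w n))"

definition Linf :: "(nat \<Rightarrow> 'a) \<Rightarrow> 'a \<Rightarrow> (nat \<Rightarrow> nat) \<Rightarrow> (nat \<Rightarrow> 'a word) set"
  where "Linf \<alpha> \<upsilon> k = {w. \<forall>i. w i \<in> L \<alpha> \<upsilon> k \<and> word_less (w i) (w (Suc i))}"

text \<open>The list \<open>ips\<close> holds the pairs of index and substitution parameter; the word \<open>w\<^sub>1 \<star> w\<^sub>2\<close> is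
  the map union \<open>w\<^sub>1 ++ w\<^sub>2\<close>.\<close>

definition EV :: "(nat \<Rightarrow> 'a) \<Rightarrow> 'a \<Rightarrow> (nat \<Rightarrow> nat) \<Rightarrow> (nat \<Rightarrow> 'a word) \<Rightarrow> 'a word set" where
  "EV \<alpha> \<upsilon> k w = {foldr (++) (map (\<lambda>(i, p). T \<alpha> \<upsilon> k p (w i)) ips) Map.empty | ips.
     sorted_wrt (<) (map fst ips) \<and> (\<forall>(i, p)\<in>set ips. p \<le> k (Suc i)) \<and> (\<exists>(i, p)\<in>set ips. p = 0)}"

definition prec ::
  "(nat \<Rightarrow> 'a) \<Rightarrow> 'a \<Rightarrow> (nat \<Rightarrow> nat) \<Rightarrow> (nat \<Rightarrow> 'a word) \<Rightarrow> (nat \<Rightarrow> 'a word) \<Rightarrow> bool" where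
  "prec \<alpha> \<upsilon> k u w \<longleftrightarrow> u \<in> Linf \<alpha> \<upsilon> k \<and> (\<forall>i. u i \<in> EV \<alpha> \<upsilon> k w)"

definition Lfin :: "(nat \<Rightarrow> 'a) \<Rightarrow> 'a \<Rightarrow> (nat \<Rightarrow> nat) \<Rightarrow> 'a word list set"
  where "Lfin \<alpha> \<upsilon> k = {t. set t \<subseteq> L \<alpha> \<upsilon> k \<and> sorted_wrt word_less t}"

definition EVfin ::
  "(nat \<Rightarrow> 'a) \<Rightarrow> 'a \<Rightarrow> (nat \<Rightarrow> nat) \<Rightarrow> (nat \<Rightarrow> 'a word) \<Rightarrow> 'a word list set"
  where "EVfin \<alpha> \<upsilon> k u = {t \<in> Lfin \<alpha> \<upsilon> k. set t \<subseteq> EV \<alpha> \<upsilon> k u}"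

definition init_seg :: "'a word list \<Rightarrow> (nat \<Rightarrow> 'a word) \<Rightarrow> bool"
  where "init_seg t w \<longleftrightarrow> (\<forall>i<length t. t ! i = w i)"

definition seq_minus :: "(nat \<Rightarrow> 'a word) \<Rightarrow> 'a word list \<Rightarrow> (nat \<Rightarrow> 'a word)" where
  "seq_minus w t = (if t = [] then w else (\<lambda>i. w ((LEAST l. word_less (last t) (w l)) + i)))"

definition basic ::
  "(nat \<Rightarrow> 'a) \<Rightarrow> 'a \<Rightarrow> (nat \<Rightarrow> nat) \<Rightarrow> 'a word list \<Rightarrow> (nat \<Rightarrow> 'a word) \<Rightarrow> (nat \<Rightarrow> 'a word) set" where
  "basic \<alpha> \<upsilon> k t s = {w \<in> Linf \<alpha> \<upsilon> k. init_seg t w \<and> prec \<alpha> \<upsilon> k (seq_minus w t) s}"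

definition TE :: "(nat \<Rightarrow> 'a) \<Rightarrow> 'a \<Rightarrow> (nat \<Rightarrow> nat) \<Rightarrow> (nat \<Rightarrow> 'a word) topology" where
  "TE \<alpha> \<upsilon> k = topology_generated_by
     {basic \<alpha> \<upsilon> k t s | t s. t \<in> Lfin \<alpha> \<upsilon> k \<and> s \<in> Linf \<alpha> \<upsilon> k}"

definition Lxi ::
  "(omega1 \<Rightarrow> nat \<Rightarrow> omega1) \<Rightarrow> (nat \<Rightarrow> 'a) \<Rightarrow> 'a \<Rightarrow> (nat \<Rightarrow> nat) \<Rightarrow> omega1 \<Rightarrow> 'a word list set" where
  "Lxi lam \<alpha> \<upsilon> k \<xi> =
     (if \<xi> = 0 then {[]}
      else {t \<in> Lfin \<alpha> \<upsilon> k. schreier lam \<xi> ((\<lambda>w. Min (dom w)) ` set t)})"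

end

theory Submission
  imports Defs
begin

text \<open>A sequence \<open>v\<close> accepts a finite sequence \<open>s\<close> if every continuation of \<open>s\<close> by \<open>x \<prec> v\<close> has an
  initial segment whose basic set over \<open>v\<close> misses \<open>U\<close>.  A fusion argument yields
  \<open>u \<prec> w - t\<close> such that each \<open>s \<in> EV\<^sup><\<^sup>\<infinity>(u)\<close> is either accepted by \<open>u\<close> or rejected, i.e. accepted by no
  \<open>v \<prec> u\<close>.  If \<open>\<emptyset>\<close> is rejected, then the pigeonhole principle for variable words and another fusion
  give \<open>v \<prec> u\<close> all of whose finite sequences are rejected, which says that \<open>U\<close> is dense in
  \<open>[t, v]\<close>.  If \<open>\<emptyset>\<close> is accepted, then the tree of the \<open>s\<close> for which \<open>[t \<odot> s, u]\<close> meets \<open>U\<close> is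
  well-founded, hence has a countable rank; for \<open>\<xi>\<close> large enough the members of \<open>\<A>\<^sub>\<xi>\<close> are longer
  than this rank allows, and a third fusion, by induction on the rank, moves \<open>L\<^sup>\<xi>\<close> out of the tree.

  The pigeonhole principle comes from idempotent ultrafilters: \<open>e\<close> minimal among those on the
  constant words, and \<open>q \<le> e\<close> on the variable words.  Each substitution maps \<open>q\<close> to an idempotent
  below \<open>e\<close>, hence to \<open>e\<close>.\<close>

section \<open>Ultrafilters on a semigroup\<close>

text \<open>Acceptance is phrased as a bar, not as \<open>[t, u]\<close> missing \<open>U\<close>,
  because \<open>U\<close> is arbitrary. Its failure for every thinning then says that
  \<open>U\<close> meets every basic set in sight, which is density and explains the closure in one
  alternative. Its success makes a tree over the countable set \<open>EV(u)\<close> well-founded,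
  which explains the countable ordinal in the other.

  The obstacle is that the admissible parameters depend on the index and may grow without bound.
  Infinitely many substitutions therefore have to be controlled at once; choosing \<open>e\<close>
  minimal before \<open>q\<close> makes all of them send \<open>q\<close> to the same ultrafilter.
  The same dependence forces combinations to carry their index sets, and finite sequences to be
  treated at a stage not later than the index of the next term.

  The threshold is \<open>omega_pow (osuc \<sigma>)\<close> for the rank \<open>\<sigma>\<close> of
  the tree: from \<open>omega_pow a\<close> on, the families have rank at least \<open>a\<close> in
  the sense of \<open>large\<close>, and \<open>a = osuc \<sigma>\<close> exceeds the rank of the
  tree.\<close>

definition ultra :: "'b filter \<Rightarrow> bool" where
  "ultra p \<longleftrightarrow> p \<noteq> bot \<and> (\<forall>P. eventually P p \<or> eventually (\<lambda>x. \<not> P x) p)"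

definition ultras :: "'b filter \<Rightarrow> 'b filter set" where
  "ultras F = {p. ultra p \<and> p \<le> F}"

lemma ultra_not: "ultra p \<Longrightarrow> eventually (\<lambda>x. \<not> P x) p \<longleftrightarrow> \<not> eventually P p"
  unfolding ultra_def using eventually_conj_iff[of P "\<lambda>x. \<not> P x" p] by auto

lemma ultra_le_eq:
  assumes "ultra p" "q \<le> p" "q \<noteq> bot"
  shows "q = p"
proof (rule antisym[OF assms(2)], rule filter_leI)
  fix P assume q: "eventually P q"
  show "eventually P p"
  proof (rule ccontr)
    assume "\<not> eventually P p"
    hence "eventually (\<lambda>x. \<not> P x) q"
      using assms(1,2) by (auto simp: ultra_not intro: filter_leD)
    with q have "eventually (\<lambda>x. False) q" by eventually_elim auto
    thus False using assms(3) by (simp add: eventually_False)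
  qed
qed

text \<open>Compactness of the space of ultrafilters in the form of Zorn's lemma: the infimum of a
  chain of proper filters is proper, since \<open>False\<close> holding eventually in it would hold
  eventually in a member. The hypothesis \<open>chain\<close> speaks of all nonempty families
  because the closedness properties in use pass to arbitrary intersections.\<close>

lemma filter_chain_minimal:
  fixes \<Phi> :: "'b filter \<Rightarrow> bool"
  assumes F0: "\<Phi> F0" "F0 \<noteq> bot"
    and chain: "\<And>C. C \<noteq> {} \<Longrightarrow> (\<And>F. F \<in> C \<Longrightarrow> \<Phi> F \<and> F \<noteq> bot) \<Longrightarrow> \<Phi> (Inf C)"
  shows "\<exists>M\<le>F0. M \<noteq> bot \<and> \<Phi> M \<and> (\<forall>G\<le>M. G \<noteq> bot \<longrightarrow> \<Phi> G \<longrightarrow> G = M)"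
proof -
  define A where "A = {F. F \<le> F0 \<and> F \<noteq> bot \<and> \<Phi> F}"
  have "\<exists>m\<in>A. \<forall>a\<in>A. a \<le> m \<longrightarrow> a = m"
  proof (rule predicate_Zorn[where P = "\<lambda>x y. y \<le> x"])
    show "partial_order_on A (relation_of (\<lambda>x y. y \<le> x) A)"
      by (rule partial_order_on_relation_ofI) auto
    fix C assume C: "C \<in> Chains (relation_of (\<lambda>x y. y \<le> x) A)"
    hence sub: "C \<subseteq> A" and tot: "\<And>F G. F \<in> C \<Longrightarrow> G \<in> C \<Longrightarrow> F \<le> G \<or> G \<le> F"
      by (auto simp: Chains_def relation_of_def)
    show "\<exists>u\<in>A. \<forall>a\<in>C. u \<le> a"
    proof (cases "C = {}")
      case True
      thus ?thesis using F0 by (auto simp: A_def)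
    next
      case False
      have base: "\<exists>x\<in>C. x \<le> inf F G" if "F \<in> C" "G \<in> C" for F G
        using that tot[OF that] by (metis le_inf_iff order.refl)
      have "Inf C \<noteq> bot"
        using eventually_Inf_base[OF False base, of "\<lambda>_. False"] sub
        by (auto simp: A_def eventually_False)
      moreover have "Inf C \<le> F0" using False sub by (auto simp: A_def intro: Inf_lower2)
      moreover have "\<Phi> (Inf C)" using sub False by (intro chain) (auto simp: A_def)
      ultimately show ?thesis by (auto simp: A_def intro: Inf_lower)
    qed
  qed
  then obtain M where "M \<in> A" "\<And>G. G \<in> A \<Longrightarrow> G \<le> M \<Longrightarrow> G = M" by blast
  thus ?thesis by (intro exI[of _ M]) (auto simp: A_def intro: order_trans)
qed

lemma ultra_below:
  assumes "F \<noteq> (bot :: 'b filter)"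
  obtains p where "p \<in> ultras F"
proof -
  obtain M where M: "M \<le> F" "M \<noteq> bot" "\<And>G. G \<le> M \<Longrightarrow> G \<noteq> bot \<Longrightarrow> G = M"
    using filter_chain_minimal[of "\<lambda>_. True" F] assms by auto
  have "eventually P M \<or> eventually (\<lambda>x. \<not> P x) M" for P
  proof (cases "inf M (principal {x. P x}) = bot")
    case True
    hence "eventually (\<lambda>_. False) (inf M (principal {x. P x}))" by simp
    thus ?thesis unfolding eventually_inf_principal by simp
  next
    case False
    hence "inf M (principal {x. P x}) = M" by (intro M) auto
    moreover have "eventually P (inf M (principal {x. P x}))"
      by (simp add: eventually_inf_principal)
    ultimately show ?thesis by simp
  qed
  thus ?thesis using that M by (auto simp: ultra_def ultras_def)
qed

text \<open>If \<open>P\<close> is eventual in \<open>G\<close> but not in \<open>F\<close>, some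
  ultrafilter refines both \<open>F\<close> and the complement of \<open>P\<close>. Inclusions
  between closed sets of ultrafilters thus become inequalities between filters.\<close>

lemma ultras_mono_iff: "ultras F \<subseteq> ultras G \<longleftrightarrow> F \<le> G"
proof
  assume sub: "ultras F \<subseteq> ultras G"
  show "F \<le> G"
  proof (rule filter_leI, rule ccontr)
    fix P assume P: "eventually P G" "\<not> eventually P F"
    hence "inf F (principal {x. \<not> P x}) \<noteq> bot"
      by (auto simp: trivial_limit_def eventually_inf_principal)
    then obtain p where p: "p \<in> ultras (inf F (principal {x. \<not> P x}))" by (rule ultra_below)
    hence "p \<le> F" "p \<le> principal {x. \<not> P x}" "ultra p" by (auto simp: ultras_def)
    moreover from this sub have "p \<le> G" by (auto simp: ultras_def)
    hence "eventually P p" using P by (auto intro: filter_leD)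
    ultimately show False
      using ultra_not[of p P] by (simp add: le_principal)
  qed
qed (auto simp: ultras_def)

lemma ultras_Inf: "p \<in> ultras (Inf C) \<longleftrightarrow> ultra p \<and> (\<forall>F\<in>C. p \<in> ultras F)"
  by (auto simp: ultras_def le_Inf_iff)

lemma ultra_filtermap: "ultra p \<Longrightarrow> ultra (filtermap g p)"
  by (auto simp: ultra_def eventually_filtermap filtermap_bot_iff)

locale filter_semigroup =
  fixes m :: "'b \<Rightarrow> 'b \<Rightarrow> 'b"
  assumes assoc: "m (m x y) z = m x (m y z)"
begin

text \<open>The product of the Stone-Cech compactification, written for all filters so that
  \<open>F \<odot> q\<close> can stand for the translate of a closed set.\<close>

definition conv :: "'b filter \<Rightarrow> 'b filter \<Rightarrow> 'b filter" (infixl "\<odot>" 70) where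
  "p \<odot> q = Abs_filter (\<lambda>P. eventually (\<lambda>x. eventually (\<lambda>y. P (m x y)) q) p)"

lemma eventually_conv:
  "eventually P (p \<odot> q) \<longleftrightarrow> eventually (\<lambda>x. eventually (\<lambda>y. P (m x y)) q) p"
  unfolding conv_def
proof (rule eventually_Abs_filter, rule is_filter.intro)
  fix P Q
  assume PQ: "\<forall>x. P x \<longrightarrow> Q x" and "\<forall>\<^sub>F x in p. \<forall>\<^sub>F y in q. P (m x y)"
  from this(2) show "\<forall>\<^sub>F x in p. \<forall>\<^sub>F y in q. Q (m x y)"
    by (rule eventually_mono) (erule eventually_mono, use PQ in auto)
qed (simp_all add: eventually_conj_iff)

lemma conv_assoc: "p \<odot> q \<odot> r = p \<odot> (q \<odot> r)"
  by (simp add: filter_eq_iff eventually_conv assoc)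

lemma conv_mono: "p \<le> p' \<Longrightarrow> q \<le> q' \<Longrightarrow> p \<odot> q \<le> p' \<odot> q'"
  unfolding le_filter_def eventually_conv
  by (intro allI impI) (rule eventually_mono, blast, blast)

lemma conv_eq_bot: "p \<odot> q = bot \<longleftrightarrow> p = bot \<or> q = bot"
  by (cases "q = bot") (simp_all add: trivial_limit_def eventually_conv)

lemma ultra_conv: "ultra p \<Longrightarrow> ultra q \<Longrightarrow> ultra (p \<odot> q)"
  unfolding ultra_def[of "p \<odot> q"] conv_eq_bot eventually_conv
  by (simp add: ultra_not) (simp add: ultra_def)

lemma filtermap_conv:
  assumes "\<And>x y. g (m x y) = m (g x) (g y)"
  shows "filtermap g (p \<odot> q) = filtermap g p \<odot> filtermap g q"
  by (simp add: filter_eq_iff eventually_filtermap eventually_conv assms)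

text \<open>Sets of ultrafilters of the form \<open>ultras F\<close> are the closed ones, so \<open>le_residual\<close> expresses
  the continuity of right multiplication by \<open>q\<close>.\<close>

definition residual :: "'b filter \<Rightarrow> 'b filter \<Rightarrow> 'b filter" where
  "residual q r = (INF P\<in>{P. eventually P r}. principal {x. eventually (\<lambda>y. P (m x y)) q})"

lemma le_residual: "p \<le> residual q r \<longleftrightarrow> p \<odot> q \<le> r"
  by (simp add: residual_def le_INF_iff le_principal le_filter_def[of "p \<odot> q"] eventually_conv)

lemma eventually_residual:
  "eventually Q (residual q r) \<longleftrightarrow>
     (\<exists>P. eventually P r \<and> (\<forall>x. eventually (\<lambda>y. P (m x y)) q \<longrightarrow> Q x))"
  unfolding residual_def
proof (subst eventually_INF_base)
  fix P P' assume "P \<in> {P. eventually P r}" "P' \<in> {P. eventually P r}"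
  thus "\<exists>Q\<in>{P. eventually P r}. principal {x. \<forall>\<^sub>F y in q. Q (m x y)}
      \<le> inf (principal {x. \<forall>\<^sub>F y in q. P (m x y)}) (principal {x. \<forall>\<^sub>F y in q. P' (m x y)})"
    by (intro bexI[of _ "\<lambda>x. P x \<and> P' x"]) (auto simp: eventually_conj_iff)
qed (auto simp: eventually_principal intro: exI[of _ "\<lambda>_. True"])

text \<open>The image of a compact set under a continuous translation is closed. In terms of
  filters, any ultrafilter below \<open>inf F (residual q r)\<close> solves
  \<open>p \<odot> q = r\<close>; were that filter \<open>bot\<close>, then
  \<open>F \<odot> q\<close> would contain the complement of a set in \<open>r\<close>.\<close>

lemma ultras_conv:
  assumes q: "ultra q"
  shows "ultras (F \<odot> q) = (\<lambda>p. p \<odot> q) ` ultras F"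
proof safe
  fix r assume "r \<in> ultras (F \<odot> q)"
  hence r: "ultra r" "r \<le> F \<odot> q" by (auto simp: ultras_def)
  have "inf F (residual q r) \<noteq> bot"
  proof
    assume "inf F (residual q r) = bot"
    hence "eventually (\<lambda>_. False) (inf F (residual q r))" by simp
    then obtain R P where R: "eventually R F" and P: "eventually P r"
      and RP: "\<And>x. R x \<Longrightarrow> \<not> eventually (\<lambda>y. P (m x y)) q"
      unfolding eventually_inf eventually_residual by blast
    have "eventually (\<lambda>x. \<not> P x) (F \<odot> q)"
      unfolding eventually_conv using R
      by (rule eventually_mono) (simp add: ultra_not[OF q] RP)
    hence "eventually (\<lambda>x. \<not> P x) r" using r by (auto intro: filter_leD)
    thus False using P r by (simp add: ultra_not)
  qed
  then obtain p where "p \<in> ultras (inf F (residual q r))" by (rule ultra_below)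
  hence p: "p \<in> ultras F" "p \<odot> q \<le> r" by (auto simp: ultras_def le_residual)
  hence "p \<odot> q = r" using r q
    by (intro ultra_le_eq) (auto simp: conv_eq_bot ultras_def ultra_def)
  thus "r \<in> (\<lambda>p. p \<odot> q) ` ultras F" using p by blast
qed (use q in \<open>auto simp: ultras_def ultra_conv intro: conv_mono\<close>)

definition subsemigroup :: "'b filter \<Rightarrow> bool" where
  "subsemigroup F \<longleftrightarrow> (\<forall>p\<in>ultras F. \<forall>q\<in>ultras F. p \<odot> q \<in> ultras F)"

text \<open>The Ellis-Numakura lemma. In a minimal closed subsemigroup \<open>M\<close>, translation
  by \<open>q\<close> gives back \<open>M\<close>, so some \<open>p\<close> fixes \<open>q\<close>
  from the left. The elements that do so (\<open>N\<close>) form a closed subsemigroup again, hence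
  all of \<open>M\<close>, and \<open>q\<close> is among them.\<close>

lemma ellis:
  assumes F: "F \<noteq> bot" "subsemigroup F"
  obtains e where "e \<in> ultras F" "e \<odot> e = e"
proof -
  have chain: "subsemigroup (Inf C)" if "C \<noteq> {}" "\<And>F. F \<in> C \<Longrightarrow> subsemigroup F \<and> F \<noteq> bot" for C
    using that by (auto simp: subsemigroup_def ultras_Inf ultra_conv)
  obtain M where M: "M \<le> F" "M \<noteq> bot" "subsemigroup M"
    and min: "\<And>G. G \<le> M \<Longrightarrow> G \<noteq> bot \<Longrightarrow> subsemigroup G \<Longrightarrow> G = M"
    using filter_chain_minimal[of subsemigroup F, OF F(2,1) chain] by blast
  obtain q where qM: "q \<in> ultras M" using M(2) by (rule ultra_below)
  hence q: "ultra q" by (simp add: ultras_def)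
  have "M \<odot> q = M"
  proof (rule min)
    show "M \<odot> q \<le> M"
      using M(3) qM by (auto simp: ultras_mono_iff[symmetric] ultras_conv[OF q] subsemigroup_def)
    show "M \<odot> q \<noteq> bot" using M q by (simp add: conv_eq_bot ultra_def)
    show "subsemigroup (M \<odot> q)"
      unfolding subsemigroup_def ultras_conv[OF q]
      using M(3) qM by (auto simp: subsemigroup_def conv_assoc[symmetric])
  qed
  then obtain p where p: "p \<in> ultras M" "p \<odot> q = q"
    using ultras_conv[OF q, of M] qM by (metis imageE)
  define N where "N = inf M (residual q q)"
  have N: "r \<in> ultras N \<longleftrightarrow> r \<in> ultras M \<and> r \<odot> q = q" for r
    using q ultra_le_eq[OF q, of "r \<odot> q"]
    by (auto simp: N_def ultras_def le_residual conv_eq_bot ultra_def)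
  have "N = M"
  proof (rule min)
    show "N \<le> M" by (simp add: N_def)
    have "p \<in> ultras N" using p N by simp
    thus "N \<noteq> bot" by (auto simp: ultras_def ultra_def bot_unique)
    show "subsemigroup N"
      using M(3) by (auto simp: subsemigroup_def N conv_assoc)
  qed
  hence "q \<odot> q = q" using qM N[of q] by simp
  thus ?thesis using qM M(1) by (intro that[of q]) (auto simp: ultras_def)
qed

text \<open>The idempotent is taken in a minimal closed left ideal \<open>M\<close>, with
  \<open>\<Phi>\<close> describing the closed left ideals. If \<open>f\<close> lies below
  \<open>e\<close>, then \<open>f = f \<odot> e\<close> is in \<open>M\<close>, so
  \<open>M = S \<odot> f\<close> by minimality, and \<open>e = x \<odot> f\<close> gives
  \<open>e \<odot> f = e\<close>.\<close>

lemma minimal_idempotent: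
  assumes S: "S \<noteq> bot" "subsemigroup S"
  obtains e where "e \<in> ultras S" "e \<odot> e = e"
    "\<And>f. f \<in> ultras S \<Longrightarrow> f \<odot> f = f \<Longrightarrow> e \<odot> f = f \<Longrightarrow> f \<odot> e = f \<Longrightarrow> f = e"
proof -
  define \<Phi> where "\<Phi> F \<longleftrightarrow> F \<le> S \<and> (\<forall>p\<in>ultras S. \<forall>q\<in>ultras F. p \<odot> q \<in> ultras F)" for F
  have \<Phi>S: "\<Phi> S" using S by (auto simp: \<Phi>_def subsemigroup_def)
  have chain: "\<Phi> (Inf C)" if "C \<noteq> {}" "\<And>F. F \<in> C \<Longrightarrow> \<Phi> F \<and> F \<noteq> bot" for C
    unfolding \<Phi>_def
  proof (intro conjI ballI)
    show "Inf C \<le> S" using that by (auto simp: \<Phi>_def intro: Inf_lower2)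
    show "p \<odot> q \<in> ultras (Inf C)" if "p \<in> ultras S" "q \<in> ultras (Inf C)" for p q
      using that \<open>\<And>F. F \<in> C \<Longrightarrow> \<Phi> F \<and> F \<noteq> bot\<close>
      by (auto simp: ultras_Inf ultra_conv \<Phi>_def) (simp add: ultras_def ultra_conv)
  qed
  obtain M where M: "M \<noteq> bot" "\<Phi> M"
    and min: "\<And>G. G \<le> M \<Longrightarrow> G \<noteq> bot \<Longrightarrow> \<Phi> G \<Longrightarrow> G = M"
    using filter_chain_minimal[of \<Phi> S, OF \<Phi>S S(1) chain] by blast
  have MS: "ultras M \<subseteq> ultras S" using M(2) unfolding ultras_mono_iff by (simp add: \<Phi>_def)
  have "subsemigroup M" using M(2) MS by (auto simp: \<Phi>_def subsemigroup_def)
  with M(1) obtain e where e: "e \<in> ultras M" "e \<odot> e = e" by (rule ellis)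
  have "f = e" if f: "f \<in> ultras S" "f \<odot> f = f" "e \<odot> f = f" "f \<odot> e = f" for f
  proof -
    have uf: "ultra f" using f by (simp add: ultras_def)
    have "f \<odot> e \<in> ultras M" using f(1) e(1) M(2) unfolding \<Phi>_def by blast
    hence fM: "f \<in> ultras M" by (simp add: f(4))
    have "S \<odot> f = M"
    proof (rule min)
      show SM: "S \<odot> f \<le> M"
        unfolding ultras_mono_iff[symmetric] ultras_conv[OF uf]
        using M(2) fM by (auto simp: \<Phi>_def)
      show "S \<odot> f \<noteq> bot" using S uf by (simp add: conv_eq_bot ultra_def)
      show "\<Phi> (S \<odot> f)"
        using SM M(2) S(2)
        by (auto simp: \<Phi>_def ultras_conv[OF uf] subsemigroup_def conv_assoc[symmetric])
    qed
    then obtain x where "e = x \<odot> f" using e(1) ultras_conv[OF uf, of S] by auto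
    hence "e \<odot> f = e" using f(2) by (simp add: conv_assoc)
    thus "f = e" using f(3) by simp
  qed
  thus ?thesis using e MS by (intro that[of e]) auto
qed

text \<open>The closed subsemigroup \<open>V \<odot> e\<close> contains an idempotent
  \<open>f\<close>, which satisfies \<open>f \<odot> e = f\<close>. Then \<open>e \<odot> f\<close>
  absorbs \<open>e\<close> on both sides and is still idempotent.\<close>

lemma idempotent_below:
  assumes e: "ultra e" "e \<odot> e = e" and V: "V \<noteq> bot" "subsemigroup V"
    and ideal: "\<And>p. p \<in> ultras V \<Longrightarrow> e \<odot> p \<in> ultras V \<and> p \<odot> e \<in> ultras V"
  obtains q where "q \<in> ultras V" "q \<odot> q = q" "e \<odot> q = q" "q \<odot> e = q"
proof -
  have "V \<odot> e \<noteq> bot" using V e by (simp add: conv_eq_bot ultra_def)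
  moreover have "subsemigroup (V \<odot> e)"
    unfolding subsemigroup_def ultras_conv[OF e(1)]
    using V(2) ideal by (auto simp: subsemigroup_def conv_assoc[symmetric])
  ultimately obtain f where f: "f \<in> ultras (V \<odot> e)" "f \<odot> f = f" by (rule ellis)
  then obtain j where j: "j \<in> ultras V" "f = j \<odot> e" using ultras_conv[OF e(1)] by auto
  have fe: "f \<odot> e = f" using j e by (simp add: conv_assoc)
  show ?thesis
  proof
    show "e \<odot> f \<in> ultras V" using j ideal by simp
    have "e \<odot> f \<odot> (e \<odot> f) = e \<odot> (f \<odot> e \<odot> f)" by (simp only: conv_assoc)
    thus "e \<odot> f \<odot> (e \<odot> f) = e \<odot> f" by (simp only: fe f(2))
    show "e \<odot> (e \<odot> f) = e \<odot> f" using e by (simp add: conv_assoc[symmetric])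
    show "e \<odot> f \<odot> e = e \<odot> f" using fe by (simp add: conv_assoc)
  qed
qed

end

section \<open>Located words\<close>

definition after :: "'a word list \<Rightarrow> 'a word \<Rightarrow> bool" where
  "after s x \<longleftrightarrow> s = [] \<or> word_less (last s) x"

lemma beforeD: "before A B \<Longrightarrow> m \<in> A \<Longrightarrow> n \<in> B \<Longrightarrow> m < n"
  by (simp add: before_def)

lemma before_bound: "(\<And>n. n \<in> A \<Longrightarrow> n \<le> M) \<Longrightarrow> before {M} B \<Longrightarrow> before A B"
  unfolding before_def by (blast intro: le_less_trans)

lemma before_trans: "before A B \<Longrightarrow> before B C \<Longrightarrow> B \<noteq> {} \<Longrightarrow> before A C"
  unfolding before_def by (meson ex_in_conv less_trans)

locale located_words =
  fixes \<alpha> :: "nat \<Rightarrow> 'a" and \<upsilon> :: 'a and k :: "nat \<Rightarrow> nat"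
  assumes \<upsilon>: "\<upsilon> \<notin> \<alpha> ` {1..}" and k_pos: "\<And>n. 1 \<le> n \<Longrightarrow> 1 \<le> k n"
    and k_mono: "mono_on {1..} k"
begin

abbreviation "subst \<equiv> T \<alpha> \<upsilon> k"
abbreviation "words \<equiv> L \<alpha> \<upsilon> k"
abbreviation "seqs \<equiv> Linf \<alpha> \<upsilon> k"
abbreviation "ev \<equiv> EV \<alpha> \<upsilon> k"
abbreviation "evfin \<equiv> EVfin \<alpha> \<upsilon> k"
abbreviation prec_syntax (infix "\<preceq>" 50) where "u \<preceq> v \<equiv> prec \<alpha> \<upsilon> k u v"

lemma k_Suc_mono: "i \<le> j \<Longrightarrow> k (Suc i) \<le> k (Suc j)"
  using k_mono by (auto simp: mono_on_def)

text \<open>Words in which the variable may be missing and the domain may be empty: constant and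
  empty combinations occur as intermediate values.\<close>

definition preword :: "'a word \<Rightarrow> bool" where
  "preword x \<longleftrightarrow> finite (dom x) \<and> 0 \<notin> dom x \<and> (\<forall>n\<in>dom x. the (x n) \<in> {\<upsilon>} \<union> \<alpha> ` {1..k n})"

lemma words_iff: "x \<in> words \<longleftrightarrow> preword x \<and> \<upsilon> \<in> ran x"
  by (auto simp: L_def preword_def ran_def)

lemma subst_0 [simp]: "subst 0 x = x"
  by (simp add: T_def)

lemma dom_subst [simp]: "dom (subst p x) = dom x"
  by (auto simp: T_def dom_def)

lemma subst_append: "subst p (x ++ y) = subst p x ++ subst p y"
  by (cases "p = 0") (auto simp: T_def map_add_def fun_eq_iff split: option.splits)

lemma subst_empty [simp]: "subst p Map.empty = Map.empty"
  by (simp add: T_def)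

lemma subst_value_ne:
  assumes "0 < n" "0 < p"
  shows "\<alpha> (min p (k n)) \<noteq> \<upsilon>" "\<alpha> (min p (k n)) \<in> \<alpha> ` {1..k n}"
  using assms \<upsilon> k_pos[of n] by (auto simp: min_def)

lemma preword_subst: "preword x \<Longrightarrow> preword (subst p x)"
  unfolding preword_def dom_subst
proof (intro conjI ballI)
  fix n assume x: "finite (dom x) \<and> 0 \<notin> dom x \<and> (\<forall>n\<in>dom x. the (x n) \<in> {\<upsilon>} \<union> \<alpha> ` {1..k n})"
    and n: "n \<in> dom x"
  hence "0 < n" by (auto intro: gr0I)
  with x n show "the (subst p x n) \<in> {\<upsilon>} \<union> \<alpha> ` {1..k n}"
    using subst_value_ne(2)[of n p] by (cases "p = 0") (auto simp: T_def)
qed auto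

lemma subst_const: "\<upsilon> \<notin> ran x \<Longrightarrow> subst p x = x"
  by (auto simp: T_def ran_def fun_eq_iff)

lemma ran_subst: "preword x \<Longrightarrow> \<upsilon> \<in> ran (subst p x) \<longleftrightarrow> p = 0 \<and> \<upsilon> \<in> ran x"
proof (cases "p = 0")
  case False
  assume x: "preword x"
  have "subst p x n \<noteq> Some \<upsilon>" for n
  proof (cases "x n = Some \<upsilon>")
    case True
    hence "0 < n" using x by (auto simp: preword_def intro: gr0I)
    thus ?thesis using True False subst_value_ne(1)[of n p] by (simp add: T_def)
  qed (simp add: T_def)
  thus ?thesis using False by (auto simp: ran_def)
qed simp

lemma preword_append: "preword x \<Longrightarrow> preword y \<Longrightarrow> preword (x ++ y)"
  unfolding preword_def dom_map_add
proof (intro conjI ballI)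
  fix n
  assume *: "finite (dom x) \<and> 0 \<notin> dom x \<and> (\<forall>n\<in>dom x. the (x n) \<in> {\<upsilon>} \<union> \<alpha> ` {1..k n})"
    "finite (dom y) \<and> 0 \<notin> dom y \<and> (\<forall>n\<in>dom y. the (y n) \<in> {\<upsilon>} \<union> \<alpha> ` {1..k n})"
    "n \<in> dom y \<union> dom x"
  show "the ((x ++ y) n) \<in> {\<upsilon>} \<union> \<alpha> ` {1..k n}"
  proof (cases "n \<in> dom y")
    case True
    thus ?thesis using * by (simp add: map_add_dom_app_simps)
  next
    case False
    thus ?thesis using * by (simp add: map_add_dom_app_simps)
  qed
qed auto

lemma words_dom:
  assumes "x \<in> words"
  shows "finite (dom x)" "dom x \<noteq> {}"
  using assms by (auto simp: L_def)

lemma seqs_words: "v \<in> seqs \<Longrightarrow> v i \<in> words"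
  by (simp add: Linf_def)

lemma word_less_iff:
  assumes "x \<in> words" "y \<in> words"
  shows "word_less x y \<longleftrightarrow> before (dom x) (dom y)"
  using words_dom[OF assms(1)] words_dom[OF assms(2)]
  by (auto simp: word_less_def before_def Max_less_iff)

lemma seqs_less:
  assumes "v \<in> seqs" "i < j"
  shows "before (dom (v i)) (dom (v j))"
  using assms(2)
proof (induction j)
  case (Suc j)
  have "before (dom (v j)) (dom (v (Suc j)))"
    using assms(1) word_less_iff by (auto simp: Linf_def)
  moreover have "dom (v j) \<noteq> {}" using words_dom(2) seqs_words[OF assms(1)] by blast
  moreover have "before (dom (v i)) (dom (v j))" if "i \<noteq> j" using that Suc by simp
  ultimately show ?case
    using before_trans by (cases "i = j") blast+
qed simp

lemma seqs_less_iff: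
  assumes "v \<in> seqs"
  shows "before (dom (v i)) (dom (v j)) \<longleftrightarrow> i < j"
proof
  assume b: "before (dom (v i)) (dom (v j))"
  obtain m n where "m \<in> dom (v i)" "n \<in> dom (v j)"
    using words_dom(2) seqs_words[OF assms] by blast
  hence "m < n" using b by (auto simp: before_def)
  have "\<not> before (dom (v j)) (dom (v i))" "i \<noteq> j"
    using b \<open>m \<in> dom (v i)\<close> \<open>n \<in> dom (v j)\<close> unfolding before_def by (meson less_asym less_irrefl)+
  thus "i < j" using seqs_less[OF assms, of j i] by (cases i j rule: linorder_cases) auto
qed (rule seqs_less[OF assms])

text \<open>Domains avoid \<open>0\<close> and move strictly to the right. Large indices thus push a
  term past any given finite set.\<close>

lemma seqs_dom_ge:
  assumes "v \<in> seqs" "n \<in> dom (v i)"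
  shows "i < n"
  using assms(2)
proof (induction i arbitrary: n)
  case 0
  thus ?case using seqs_words[OF assms(1), of 0] by (auto simp: L_def intro: gr0I)
next
  case (Suc i)
  obtain m where m: "m \<in> dom (v i)" using words_dom(2) seqs_words[OF assms(1)] by blast
  have "m < n" using m Suc.prems seqs_less[OF assms(1), of i "Suc i"] unfolding before_def by blast
  with Suc.IH[OF m] show ?case by simp
qed

text \<open>\<open>comb v I b x\<close>: the word \<open>x\<close> is a combination of terms of \<open>v\<close> with indices in \<open>I\<close>, and \<open>b\<close>
  tells whether one of the substitution parameters is \<open>0\<close>.\<close>

inductive comb :: "(nat \<Rightarrow> 'a word) \<Rightarrow> nat set \<Rightarrow> bool \<Rightarrow> 'a word \<Rightarrow> bool" for v where
  empty: "comb v I False Map.empty"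
| step: "i \<in> I \<Longrightarrow> p \<le> k (Suc i) \<Longrightarrow> comb v {j\<in>I. i < j} b x \<Longrightarrow>
    comb v I (p = 0 \<or> b) (subst p (v i) ++ x)"

lemma comb_iff_list:
  "comb v I b x \<longleftrightarrow> (\<exists>ips. x = foldr (++) (map (\<lambda>(i, p). subst p (v i)) ips) Map.empty \<and>
     sorted_wrt (<) (map fst ips) \<and> (\<forall>(i, p)\<in>set ips. i \<in> I \<and> p \<le> k (Suc i)) \<and>
     b = (\<exists>(i, p)\<in>set ips. p = 0))" (is "_ \<longleftrightarrow> (\<exists>ips. ?P I b x ips)")
proof
  show "comb v I b x \<Longrightarrow> \<exists>ips. ?P I b x ips"
  proof (induction rule: comb.induct)
    case (empty I)
    show ?case by (intro exI[of _ "[]"]) auto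
  next
    case (step i I p b x)
    then obtain ips where "?P {j\<in>I. i < j} b x ips" by blast
    with step.hyps show ?case by (intro exI[of _ "(i, p) # ips"]) auto
  qed
  have "?P I b x ips \<Longrightarrow> comb v I b x" for ips
  proof (induction ips arbitrary: I b x)
    case Nil
    thus ?case using comb.empty by simp
  next
    case (Cons ip ips)
    obtain i p where [simp]: "ip = (i, p)" by fastforce
    define b' where "b' = (\<exists>(i, p)\<in>set ips. p = 0)"
    have "comb v {j\<in>I. i < j} b' (foldr (++) (map (\<lambda>(i, p). subst p (v i)) ips) Map.empty)"
      using Cons.prems by (intro Cons.IH) (auto simp: b'_def)
    moreover have "b = (p = 0 \<or> b')" using Cons.prems by (auto simp: b'_def)
    ultimately show ?case using comb.step[of i I p v b'] Cons.prems by auto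
  qed
  thus "\<exists>ips. ?P I b x ips \<Longrightarrow> comb v I b x" by blast
qed

lemma ev_iff: "x \<in> ev v \<longleftrightarrow> comb v UNIV True x"
  unfolding EV_def comb_iff_list by auto

lemma comb_mono: "comb v I b x \<Longrightarrow> I \<subseteq> J \<Longrightarrow> comb v J b x"
  unfolding comb_iff_list by blast

lemma comb_single: "i \<in> I \<Longrightarrow> p \<le> k (Suc i) \<Longrightarrow> comb v I (p = 0) (subst p (v i))"
  using comb.step[OF _ _ comb.empty, of i I p v] by simp

lemma comb_dom: "comb v I b x \<Longrightarrow> n \<in> dom x \<Longrightarrow> \<exists>i\<in>I. n \<in> dom (v i)"
  by (induction rule: comb.induct) auto

text \<open>Substitution keeps domains, so the whole domain of a term in use lies in that of the
  combination. This is how indices are compared later: by looking at domains.\<close>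

lemma comb_tight: "comb v I b x \<Longrightarrow> dom x \<subseteq> D \<Longrightarrow> comb v {i\<in>I. dom (v i) \<subseteq> D} b x"
proof (induction rule: comb.induct)
  case (step i I p b x)
  hence "comb v {j\<in>{i\<in>I. dom (v i) \<subseteq> D}. i < j} b x"
    by (auto elim: comb_mono)
  with step show ?case by (intro comb.step) auto
qed (rule comb.empty)

lemma comb_append:
  "comb v I b x \<Longrightarrow> comb v J c y \<Longrightarrow> (\<And>i j. i \<in> I \<Longrightarrow> j \<in> J \<Longrightarrow> i < j) \<Longrightarrow>
    comb v (I \<union> J) (b \<or> c) (x ++ y)"
proof (induction rule: comb.induct)
  case (step i I p b x)
  hence "comb v ({j\<in>I. i < j} \<union> J) (b \<or> c) (x ++ y)" by auto
  hence "comb v {j\<in>I \<union> J. i < j} (b \<or> c) (x ++ y)"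
    using step by (auto elim!: comb_mono)
  from comb.step[OF _ step.hyps(2) this] step.hyps show ?case by simp
qed (auto elim: comb_mono)

lemma comb_index: "comb v I True x \<Longrightarrow> \<exists>i\<in>I. dom (v i) \<subseteq> dom x"
  by (induction I "True" x rule: comb.induct) auto

lemma comb_append_before:
  assumes v: "v \<in> seqs" and "comb v I b x" "comb v J c y" and less: "before (dom x) (dom y)"
  shows "comb v (I \<union> J) (b \<or> c) (x ++ y)"
proof -
  have "comb v ({i\<in>I. dom (v i) \<subseteq> dom x} \<union> {i\<in>J. dom (v i) \<subseteq> dom y}) (b \<or> c) (x ++ y)"
  proof (rule comb_append)
    fix i j assume "i \<in> {i\<in>I. dom (v i) \<subseteq> dom x}" "j \<in> {i\<in>J. dom (v i) \<subseteq> dom y}"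
    hence "before (dom (v i)) (dom (v j))" using less unfolding before_def by blast
    thus "i < j" by (simp add: seqs_less_iff[OF v])
  qed (intro comb_tight assms order.refl)+
  thus ?thesis by (rule comb_mono) auto
qed

lemma comb_before:
  assumes "v \<in> seqs" "comb v {j\<in>I. i < j} b x"
  shows "before (dom (v i)) (dom x)"
  using comb_dom[OF assms(2)] seqs_less[OF assms(1)] unfolding before_def by blast

lemma comb_preword:
  "comb v I b x \<Longrightarrow> v \<in> seqs \<Longrightarrow> preword x \<and> (\<upsilon> \<in> ran x \<longleftrightarrow> b)"
proof (induction rule: comb.induct)
  case (step i I p b x)
  have i: "preword (v i)" "\<upsilon> \<in> ran (v i)"
    using seqs_words[OF step.prems, of i] by (auto simp: words_iff)
  have "before (dom (v i)) (dom x)" using comb_before[OF step.prems step.hyps(3)] .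
  hence "dom (subst p (v i)) \<inter> dom x = {}" by (auto simp: before_def)
  hence "ran (subst p (v i) ++ x) = ran (subst p (v i)) \<union> ran x" by (rule ran_map_add)
  thus ?case using step i by (simp add: preword_append preword_subst ran_subst)
qed (auto simp: preword_def)

lemma ev_words: "v \<in> seqs \<Longrightarrow> x \<in> ev v \<Longrightarrow> x \<in> words"
  using comb_preword by (auto simp: ev_iff words_iff)

lemma subst_subst:
  assumes "preword x"
  shows "subst p (subst q x) = (if q = 0 then subst p x else subst q x)"
proof (cases "q = 0")
  case False
  hence "\<upsilon> \<notin> ran (subst q x)" using ran_subst[OF assms] by simp
  thus ?thesis using False by (simp add: subst_const)
qed simp

lemma comb_subst:
  "comb v I b x \<Longrightarrow> v \<in> seqs \<Longrightarrow> (\<And>i. i \<in> I \<Longrightarrow> p \<le> k (Suc i)) \<Longrightarrow>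
    comb v I (p = 0 \<and> b) (subst p x)"
proof (induction rule: comb.induct)
  case (step i I q b x)
  have i: "preword (v i)" using seqs_words[OF step.prems(1), of i] by (auto simp: words_iff)
  define r where "r = (if q = 0 then p else q)"
  have "comb v I (r = 0 \<or> p = 0 \<and> b) (subst r (v i) ++ subst p x)"
    using step by (intro comb.step) (auto simp: r_def)
  moreover have "(r = 0 \<or> p = 0 \<and> b) \<longleftrightarrow> p = 0 \<and> (q = 0 \<or> b)" if "p = 0 \<or> q = 0"
    using that by (auto simp: r_def)
  moreover have "subst r (v i) ++ subst p x = subst p (subst q (v i) ++ x)"
    by (auto simp: subst_append subst_subst[OF i] r_def)
  ultimately show ?case by (cases "p = 0 \<or> q = 0") (auto simp: r_def)
qed (auto intro: comb.empty)

lemma comb_trans: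
  "comb u I b x \<Longrightarrow> u \<in> seqs \<Longrightarrow> v \<in> seqs \<Longrightarrow> (\<And>i. i \<in> I \<Longrightarrow> comb v {i..} True (u i)) \<Longrightarrow>
    comb v UNIV b x"
proof (induction rule: comb.induct)
  case (step i I p b x)
  have "comb v {i..} (p = 0 \<and> True) (subst p (u i))"
    using step.hyps(2) k_Suc_mono by (intro comb_subst step.prems step.hyps) (auto intro: le_trans)
  moreover have "comb v UNIV b x" using step by auto
  moreover have "before (dom (subst p (u i))) (dom x)"
    using comb_before[OF step.prems(1) step.hyps(3)] by simp
  ultimately show ?case using comb_append_before[OF step.prems(2)] by fastforce
qed (rule comb.empty)

text \<open>The bound on substitution parameters depends on the index.  As the index can only grow in
  passing from \<open>u\<close> to \<open>v\<close>, the parameters admitted for \<open>u\<close> are admitted for \<open>v\<close>.\<close>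

lemma prec_comb:
  assumes uv: "u \<preceq> v" and v: "v \<in> seqs"
  shows "comb v {i..} True (u i)"
proof -
  have u: "u \<in> seqs" "\<And>i. comb v UNIV True (u i)"
    using uv by (auto simp: prec_def ev_iff)
  have "i \<le> j" if "dom (v j) \<subseteq> dom (u i)" for i j
    using that
  proof (induction i arbitrary: j)
    case (Suc i)
    obtain j' where j': "dom (v j') \<subseteq> dom (u i)" using comb_index[OF u(2)] by blast
    have "before (dom (v j')) (dom (v j))"
      using j' Suc.prems seqs_less[OF u(1), of i "Suc i"] unfolding before_def by blast
    hence "j' < j" using seqs_less_iff[OF v] by simp
    thus ?case using Suc.IH[OF j'] by simp
  qed simp
  hence "{j \<in> UNIV. dom (v j) \<subseteq> dom (u i)} \<subseteq> {i..}" by auto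
  thus ?thesis using comb_mono comb_tight[OF u(2) order.refl] by blast
qed

lemma prec_ev_mono: "u \<preceq> v \<Longrightarrow> v \<in> seqs \<Longrightarrow> ev u \<subseteq> ev v"
  using comb_trans[of u UNIV True _ v] prec_comb by (auto simp: ev_iff prec_def)

lemma ev_self: "v i \<in> ev v"
  using comb_single[of i UNIV 0 v] by (simp add: ev_iff)

lemma prec_refl: "v \<in> seqs \<Longrightarrow> v \<preceq> v"
  by (simp add: prec_def ev_self)

lemma prec_seqs: "u \<preceq> v \<Longrightarrow> u \<in> seqs"
  by (simp add: prec_def)

lemma prec_trans: "u \<preceq> v \<Longrightarrow> v \<preceq> w \<Longrightarrow> w \<in> seqs \<Longrightarrow> u \<preceq> w"
  using prec_ev_mono[of v w] by (auto simp: prec_def)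

lemma seqs_subseq: "v \<in> seqs \<Longrightarrow> strict_mono r \<Longrightarrow> v \<circ> r \<in> seqs"
  unfolding Linf_def[of \<alpha> \<upsilon> k]
proof (intro CollectI allI conjI)
  fix i
  assume v: "v \<in> {w. \<forall>i. w i \<in> words \<and> word_less (w i) (w (Suc i))}" and r: "strict_mono r"
  hence v': "v \<in> seqs" by (simp add: Linf_def)
  show "(v \<circ> r) i \<in> words" using seqs_words[OF v'] by simp
  show "word_less ((v \<circ> r) i) ((v \<circ> r) (Suc i))"
    using seqs_less[OF v', of "r i" "r (Suc i)"] r seqs_words[OF v']
    by (simp add: word_less_iff strict_mono_Suc_iff)
qed

lemma prec_subseq: "v \<in> seqs \<Longrightarrow> strict_mono r \<Longrightarrow> v \<circ> r \<preceq> v"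
  by (simp add: prec_def seqs_subseq ev_self)

section \<open>The pigeonhole principle\<close>

interpretation filter_semigroup "(++) :: 'a word \<Rightarrow> 'a word \<Rightarrow> 'a word"
  by unfold_locales simp

abbreviation word_conv :: "'a word filter \<Rightarrow> 'a word filter \<Rightarrow> 'a word filter" (infixl "\<odot>" 70)
  where "p \<odot> q \<equiv> filter_semigroup.conv (++) p q"

text \<open>Its ultrafilters live on combinations beyond every position: variable words for
  \<open>b = True\<close>, constant words, including the empty one, for \<open>b = False\<close>.
  Map union is total, but along these filters the right factor lies beyond the left one, where it is
  concatenation.\<close>

definition comb_filter :: "(nat \<Rightarrow> 'a word) \<Rightarrow> bool \<Rightarrow> 'a word filter" where
  "comb_filter v b = (INF N. principal {x. comb v UNIV b x \<and> before {N} (dom x)})"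

lemma le_comb_filter:
  "p \<le> comb_filter v b \<longleftrightarrow> (\<forall>N. eventually (\<lambda>x. comb v UNIV b x \<and> before {N} (dom x)) p)"
  by (simp add: comb_filter_def le_INF_iff le_principal)

lemma comb_filter_not_bot:
  assumes "v \<in> seqs"
  shows "comb_filter v b \<noteq> bot"
proof -
  have "eventually P (comb_filter v b) \<longleftrightarrow>
      (\<exists>N\<in>UNIV. eventually P (principal {x. comb v UNIV b x \<and> before {N} (dom x)}))" for P
    unfolding comb_filter_def
  proof (rule eventually_INF_base)
    fix N N' :: nat
    show "\<exists>n\<in>UNIV. principal {x. comb v UNIV b x \<and> before {n} (dom x)}
      \<le> inf (principal {x. comb v UNIV b x \<and> before {N} (dom x)})
          (principal {x. comb v UNIV b x \<and> before {N'} (dom x)})"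
      by (intro bexI[of _ "max N N'"]) (auto simp: before_def)
  qed simp
  moreover have "\<exists>x. comb v UNIV b x \<and> before {N} (dom x)" for N
  proof (cases b)
    case True
    have "before {N} (dom (v N))" using seqs_dom_ge[OF assms, of _ N] unfolding before_def by blast
    thus ?thesis using ev_self[of v N] True by (auto simp: ev_iff)
  next
    case False
    thus ?thesis using comb.empty[of v UNIV] by (auto simp: before_def)
  qed
  ultimately show ?thesis
    by (simp add: trivial_limit_def eventually_principal)
qed

text \<open>For fixed \<open>x\<close>, almost every \<open>y\<close> lies beyond
  \<open>dom x\<close>. The disjunction \<open>b \<or> c\<close> makes the variable words a
  two-sided ideal, as \<open>idempotent_below\<close> requires.\<close>

lemma conv_comb_filter:
  assumes v: "v \<in> seqs" and p: "p \<le> comb_filter v b" and q: "q \<le> comb_filter v c"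
  shows "p \<odot> q \<le> comb_filter v (b \<or> c)"
  unfolding le_comb_filter eventually_conv
proof
  fix N
  from p have "\<forall>\<^sub>F x in p. comb v UNIV b x \<and> before {N} (dom x)" by (simp add: le_comb_filter)
  thus "\<forall>\<^sub>F x in p. \<forall>\<^sub>F y in q. comb v UNIV (b \<or> c) (x ++ y) \<and> before {N} (dom (x ++ y))"
  proof eventually_elim
    case (elim x)
    hence "finite (dom x)" using comb_preword[OF _ v] by (auto simp: preword_def)
    define M where "M = Max (insert N (dom x))"
    from q have "\<forall>\<^sub>F y in q. comb v UNIV c y \<and> before {M} (dom y)" by (simp add: le_comb_filter)
    thus ?case
    proof eventually_elim
      case (elim y)
      have M: "n \<le> M" if "n \<in> insert N (dom x)" for n
        using \<open>finite (dom x)\<close> that unfolding M_def by (intro Max_ge) auto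
      have "before (dom x) (dom y)" "before {N} (dom y)"
        using elim M by (auto intro!: before_bound[of _ M "dom y"])
      thus ?case
        using \<open>comb v UNIV b x \<and> before {N} (dom x)\<close> elim comb_append_before[OF v, of UNIV b x UNIV c y]
        by (simp add: before_def ball_Un)
    qed
  qed
qed

lemma subsemigroup_comb_filter: "v \<in> seqs \<Longrightarrow> filter_semigroup.subsemigroup (++) (comb_filter v b)"
  using conv_comb_filter[of v _ b _ b] by (auto simp: subsemigroup_def ultras_def ultra_conv)

lemma filtermap_subst_le:
  assumes v: "v \<in> seqs" and q: "q \<le> comb_filter v True" and r: "1 \<le> r" "r \<le> k (Suc i)"
  shows "filtermap (subst r) q \<le> comb_filter v False"
  unfolding le_comb_filter eventually_filtermap dom_subst
proof
  fix N
  obtain n where n: "n \<in> dom (v i)" using words_dom(2) seqs_words[OF v] by blast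
  from q have "\<forall>\<^sub>F x in q. comb v UNIV True x \<and> before {max N n} (dom x)"
    by (simp add: le_comb_filter)
  thus "\<forall>\<^sub>F x in q. comb v UNIV False (subst r x) \<and> before {N} (dom x)"
  proof eventually_elim
    case (elim x)
    have "r \<le> k (Suc j)" if j: "dom (v j) \<subseteq> dom x" for j
    proof -
      obtain l where l: "l \<in> dom (v j)" using words_dom(2) seqs_words[OF v] by blast
      hence "n < l" using j elim by (auto simp: before_def)
      hence "\<not> before (dom (v j)) (dom (v i))" using l n beforeD by fastforce
      hence "i \<le> j" by (simp add: seqs_less_iff[OF v])
      thus ?thesis using r(2) k_Suc_mono le_trans by blast
    qed
    hence "comb v {i\<in>UNIV. dom (v i) \<subseteq> dom x} (r = 0 \<and> True) (subst r x)"
      using elim by (intro comb_subst comb_tight v) auto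
    hence "comb v UNIV False (subst r x)" using r by (auto elim: comb_mono)
    thus ?case using elim by (simp add: before_def)
  qed
qed

lemma filtermap_subst_const:
  assumes v: "v \<in> seqs" and e: "e \<le> comb_filter v False"
  shows "filtermap (subst r) e = e"
proof -
  have "\<forall>\<^sub>F x in e. comb v UNIV False x" using e[unfolded le_comb_filter, rule_format, of 0]
    by (rule eventually_mono) simp
  hence id: "\<forall>\<^sub>F x in e. subst r x = x"
    by (rule eventually_mono) (use comb_preword[OF _ v] subst_const in blast)
  have "eventually (\<lambda>x. P (subst r x)) e \<longleftrightarrow> eventually P e" for P
    by (rule eventually_subst, rule eventually_mono[OF id]) simp
  thus ?thesis by (simp add: filter_eq_iff eventually_filtermap)
qed

lemma variable_idempotent:
  assumes v: "v \<in> seqs"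
  obtains q e where "ultra q" "q \<le> comb_filter v True" "ultra e" "e \<odot> e = e"
    "q \<odot> q = q" "e \<odot> q = q" "q \<odot> e = q"
    "\<And>r i. 1 \<le> r \<Longrightarrow> r \<le> k (Suc i) \<Longrightarrow> filtermap (subst r) q = e"
proof -
  obtain e where e: "e \<in> ultras (comb_filter v False)" "e \<odot> e = e"
    and min: "\<And>f. f \<in> ultras (comb_filter v False) \<Longrightarrow> f \<odot> f = f \<Longrightarrow> e \<odot> f = f \<Longrightarrow> f \<odot> e = f \<Longrightarrow> f = e"
    using minimal_idempotent[OF comb_filter_not_bot[OF v] subsemigroup_comb_filter[OF v]] by blast
  hence e': "ultra e" "e \<le> comb_filter v False" by (auto simp: ultras_def)
  obtain q where q: "q \<in> ultras (comb_filter v True)" "q \<odot> q = q" "e \<odot> q = q" "q \<odot> e = q"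
  proof (rule idempotent_below[OF e'(1) e(2) comb_filter_not_bot[OF v] subsemigroup_comb_filter[OF v]])
    show "e \<odot> p \<in> ultras (comb_filter v True) \<and> p \<odot> e \<in> ultras (comb_filter v True)"
      if "p \<in> ultras (comb_filter v True)" for p
      using that conv_comb_filter[OF v e'(2), of p True] conv_comb_filter[OF v _ e'(2), of p True]
      by (simp add: ultras_def ultra_conv e')
  qed blast
  have "filtermap (subst r) q = e" if r: "1 \<le> r" "r \<le> k (Suc i)" for r i
  proof (rule min)
    show "filtermap (subst r) q \<in> ultras (comb_filter v False)"
      using filtermap_subst_le[OF v _ r] q by (auto simp: ultras_def ultra_filtermap)
    note h = filtermap_conv[of "subst r", OF subst_append]
    show "filtermap (subst r) q \<odot> filtermap (subst r) q = filtermap (subst r) q"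
      using h[of q q] q(2) by simp
    show "e \<odot> filtermap (subst r) q = filtermap (subst r) q"
      using h[of e q] q(3) by (simp add: filtermap_subst_const[OF v e'(2)])
    show "filtermap (subst r) q \<odot> e = filtermap (subst r) q"
      using h[of q e] q(4) by (simp add: filtermap_subst_const[OF v e'(2)])
  qed
  thus ?thesis using that[of q e] q e e' by (simp add: ultras_def)
qed

section \<open>Combinations of initial parts of a sequence\<close>

lemma comb_cong: "comb u I b x \<Longrightarrow> (\<And>i. i \<in> I \<Longrightarrow> u i = u' i) \<Longrightarrow> comb u' I b x"
proof (induction rule: comb.induct)
  case (step i I p b x)
  thus ?case using comb.step[of i I p u' b x] by simp
qed (rule comb.empty)

lemma comb_no_index: "comb u {} b x \<Longrightarrow> \<not> b \<and> x = Map.empty"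
  by (erule comb.cases) auto

text \<open>\<open>comb\<close> is built from its first index, whereas the recursive constructions
  extend a sequence at its end; this supplies the recursion at the largest index.\<close>

lemma comb_last:
  "comb u I b x \<Longrightarrow> (\<And>i. i \<in> I \<Longrightarrow> i \<le> m) \<Longrightarrow> comb u (I - {m}) b x \<or>
    (\<exists>c y p. comb u (I - {m}) c y \<and> p \<le> k (Suc m) \<and> x = y ++ subst p (u m) \<and> b = (p = 0 \<or> c))"
proof (induction rule: comb.induct)
  case (step i I p b x)
  show ?case
  proof (cases "i = m")
    case True
    hence "{j\<in>I. i < j} = {}" using step.prems by force
    hence "\<not> b" "x = Map.empty" using step.hyps(3) comb_no_index by metis+
    thus ?thesis using True step.hyps comb.empty[of u "I - {m}"] by fastforce
  next
    case False
    have step': "comb u (I - {m}) (p = 0 \<or> c) (subst p (u i) ++ y)"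
      if "comb u ({j\<in>I. i < j} - {m}) c y" for c y
    proof (rule comb.step)
      show "comb u {j\<in>I - {m}. i < j} c y" using that by (rule comb_mono) auto
    qed (use False step.hyps in auto)
    from step have "comb u ({j\<in>I. i < j} - {m}) b x \<or>
      (\<exists>c y p. comb u ({j\<in>I. i < j} - {m}) c y \<and> p \<le> k (Suc m) \<and> x = y ++ subst p (u m) \<and>
        b = (p = 0 \<or> c))" by auto
    thus ?thesis
    proof
      assume "comb u ({j\<in>I. i < j} - {m}) b x"
      thus ?thesis using step' by blast
    next
      assume "\<exists>c y p. comb u ({j\<in>I. i < j} - {m}) c y \<and> p \<le> k (Suc m) \<and> x = y ++ subst p (u m) \<and>
        b = (p = 0 \<or> c)"
      then obtain c y r where *: "comb u ({j\<in>I. i < j} - {m}) c y" "r \<le> k (Suc m)"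
        "x = y ++ subst r (u m)" "b = (r = 0 \<or> c)" by blast
      hence "comb u (I - {m}) (p = 0 \<or> c) (subst p (u i) ++ y)"
        using step' by blast
      thus ?thesis using * by (intro disjI2 exI[of _ "p = 0 \<or> c"] exI[of _ "subst p (u i) ++ y"]
            exI[of _ r]) auto
    qed
  qed
qed (simp add: comb.empty)

lemma comb_Suc:
  assumes "comb u {..<Suc m} b x"
  obtains "comb u {..<m} b x"
  | c y p where "comb u {..<m} c y" "p \<le> k (Suc m)" "x = y ++ subst p (u m)" "b = (p = 0 \<or> c)"
proof -
  have "{..<Suc m} - {m} = {..<m}" by auto
  thus ?thesis using comb_last[OF assms, of m] that by fastforce
qed

text \<open>The parameters are bounded by \<open>k\<close>. Finiteness lets one event of an
  ultrafilter, or finitely many thinnings, take care of all combinations of the terms chosen so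
  far.\<close>

lemma finite_comb: "finite {(b, x). comb u {..<m} b x}"
proof (induction m)
  case 0
  have "{(b, x). comb u {..<0} b x} \<subseteq> {(False, Map.empty)}"
    using comb_no_index by auto
  thus ?case by (rule finite_subset) simp
next
  case (Suc m)
  define A where "A = {(b, x). comb u {..<m} b x}"
  have "{(b, x). comb u {..<Suc m} b x} \<subseteq>
      A \<union> (\<Union>(c, y)\<in>A. \<Union>p\<in>{..k (Suc m)}. {(p = 0 \<or> c, y ++ subst p (u m))})"
  proof safe
    fix b x
    assume "comb u {..<Suc m} b x" and
      *: "(b, x) \<notin> (\<Union>(c, y)\<in>A. \<Union>p\<in>{..k (Suc m)}. {(p = 0 \<or> c, y ++ subst p (u m))})"
    from this(1) show "(b, x) \<in> A"
    proof (cases rule: comb_Suc)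
      case (2 c y p)
      hence "(c, y) \<in> A" "p \<in> {..k (Suc m)}" by (auto simp: A_def)
      thus ?thesis using * 2 by fast
    qed (simp add: A_def)
  qed
  moreover have "finite (A \<union> (\<Union>(c, y)\<in>A. \<Union>p\<in>{..k (Suc m)}. {(p = 0 \<or> c, y ++ subst p (u m))}))"
    using Suc by (auto simp: A_def)
  ultimately show ?case by (rule finite_subset)
qed

lemma comb_finite_index: "comb u UNIV b x \<Longrightarrow> \<exists>m. comb u {..<m} b x"
proof -
  assume "comb u UNIV b x"
  then obtain ips where "x = foldr (++) (map (\<lambda>(i, p). subst p (u i)) ips) Map.empty"
    "sorted_wrt (<) (map fst ips)" "\<forall>(i, p)\<in>set ips. p \<le> k (Suc i)"
    "b = (\<exists>(i, p)\<in>set ips. p = 0)" unfolding comb_iff_list by auto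
  moreover have "\<forall>(i, p)\<in>set ips. i < Suc (Max (fst ` set ips))"
    by (auto simp: less_Suc_eq_le intro!: Max_ge) force
  ultimately have "comb u {..<Suc (Max (fst ` set ips))} b x"
    unfolding comb_iff_list by (intro exI[of _ ips]) auto
  thus ?thesis ..
qed

text \<open>The Galvin-Glazer recursion. A new term with parameter \<open>0\<close> behaves like a
  word drawn from \<open>q\<close>, one with positive parameter like a word drawn from
  \<open>e\<close>; in both cases the invariant survives for almost every choice.\<close>

lemma pigeonhole_ultra:
  assumes v: "v \<in> seqs" and q: "ultra q" "q \<le> comb_filter v True" and e: "ultra e" "e \<odot> e = e"
    and qe: "q \<odot> q = q" "e \<odot> q = q" "q \<odot> e = q"
    and sub: "\<And>r i. 1 \<le> r \<Longrightarrow> r \<le> k (Suc i) \<Longrightarrow> filtermap (subst r) q = e"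
    and A: "eventually A q"
  shows "\<exists>u. u \<preceq> v \<and> (\<forall>x\<in>ev u. A x)"
proof -
  \<comment> \<open>the invariant for combinations \<open>x\<close> of the terms chosen so far, with \<open>b\<close> as in \<open>comb\<close>\<close>
  define D where "D b x \<longleftrightarrow> (\<forall>\<^sub>F y in q. A (x ++ y)) \<and>
    (b \<longrightarrow> A x \<and> (\<forall>\<^sub>F y in e. A (x ++ y)))" for b x
  have conv: "(\<forall>\<^sub>F y in p. \<forall>\<^sub>F z in p'. A (x ++ y ++ z)) \<longleftrightarrow> (\<forall>\<^sub>F y in p \<odot> p'. A (x ++ y))"
    for p p' x by (simp add: eventually_conv)
  \<comment> \<open>All clauses of \<open>D True\<close> reduce to the first clause for
    \<open>x\<close>, by \<open>q \<odot> q = q\<close> and \<open>q \<odot> e = q\<close>.\<close>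
  have Dq: "\<forall>\<^sub>F y in q. D True (x ++ y)" if "D b x" for b x
    using that by (simp add: D_def eventually_conj_iff conv qe)
  \<comment> \<open>Here the reductions use \<open>e \<odot> q = q\<close> and, if \<open>b\<close>
    holds, \<open>e \<odot> e = e\<close>.\<close>
  have De: "\<forall>\<^sub>F y in e. D b (x ++ y)" if "D b x" for b x
    using that by (cases b) (simp_all add: D_def eventually_conj_iff conv qe e)
  have D_subst: "\<forall>\<^sub>F y in q. D (p = 0 \<or> b) (x ++ subst p y)" if "D b x" "p \<le> k (Suc m)" for p b x m
  proof (cases "p = 0")
    case True
    thus ?thesis using Dq[OF that(1)] by simp
  next
    case False
    hence "\<forall>\<^sub>F y in filtermap (subst p) q. D b (x ++ y)" using De that sub[of p m] by simp
    thus ?thesis using False by (simp add: eventually_filtermap)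
  qed
  define P where "P u m r \<longleftrightarrow> r \<in> ev v \<and> (\<forall>i<m. before (dom (u i)) (dom r)) \<and>
    (\<forall>(b, x)\<in>{(b, x). comb u {..<m} b x}. \<forall>p\<in>{..k (Suc m)}. D (p = 0 \<or> b) (x ++ subst p r))"
    for u :: "nat \<Rightarrow> 'a word" and m r
  have D_comb: "D b x" if "comb u {..<m} b x" "\<And>i. i < m \<Longrightarrow> P u i (u i)" for u m b x
    using that
  proof (induction m arbitrary: b x)
    case 0
    thus ?case using comb_no_index[of u b x] A by (simp add: D_def)
  next
    case (Suc m)
    from Suc.prems(1) show ?case
    proof (cases rule: comb_Suc)
      case 1
      thus ?thesis using Suc by simp
    next
      case (2 c y p)
      thus ?thesis using Suc.prems(2)[of m] by (auto simp: P_def)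
    qed
  qed
  have "\<exists>u. \<forall>m. P u m (u m)"
  proof (rule dependent_wellorder_choice)
    fix r m and f g :: "nat \<Rightarrow> 'a word"
    assume fg: "\<And>y. y < m \<Longrightarrow> f y = g y"
    hence "comb f {..<m} b x \<longleftrightarrow> comb g {..<m} b x" for b x
      using comb_cong[of f "{..<m}" b x g] comb_cong[of g "{..<m}" b x f] by auto
    thus "P f m r = P g m r" using fg by (simp add: P_def)
  next
    fix m u assume IH: "\<And>y. y < m \<Longrightarrow> P u y (u y)"
    have "\<forall>\<^sub>F r in q. \<forall>(b, x)\<in>{(b, x). comb u {..<m} b x}. \<forall>p\<in>{..k (Suc m)}.
        D (p = 0 \<or> b) (x ++ subst p r)"
    proof (rule eventually_ball_finite[OF finite_comb], safe)
      fix b x assume "comb u {..<m} b x"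
      hence "D b x" using D_comb IH by blast
      thus "\<forall>\<^sub>F r in q. \<forall>p\<in>{..k (Suc m)}. D (p = 0 \<or> b) (x ++ subst p r)"
        by (intro eventually_ball_finite) (auto intro: D_subst)
    qed
    moreover define N where "N = Max (insert 0 (\<Union>i<m. dom (u i)))"
    have "\<forall>\<^sub>F r in q. comb v UNIV True r \<and> before {N} (dom r)" using q by (simp add: le_comb_filter)
    ultimately have "\<forall>\<^sub>F r in q. P u m r"
    proof eventually_elim
      case (elim r)
      have "finite (\<Union>i<m. dom (u i))"
        using IH ev_words[OF v] words_dom(1) by (auto simp: P_def)
      hence "n \<le> N" if "i < m" "n \<in> dom (u i)" for i n
        unfolding N_def using that by (intro Max_ge) auto
      hence "\<forall>i<m. before (dom (u i)) (dom r)"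
        using elim by (auto intro!: before_bound[of _ N "dom r"])
      thus ?case using elim unfolding P_def ev_iff by blast
    qed
    thus "\<exists>r. P u m r" using q(1) eventually_happens unfolding ultra_def by blast
  qed
  then obtain u where u: "\<And>m. P u m (u m)" by blast
  have "u i \<in> words" for i using u[of i] ev_words[OF v] by (simp add: P_def)
  moreover have "before (dom (u i)) (dom (u (Suc i)))" for i using u[of "Suc i"] by (simp add: P_def)
  ultimately have "u \<in> seqs" by (simp add: Linf_def word_less_iff)
  hence "u \<preceq> v" using u by (simp add: prec_def P_def)
  moreover have "A x" if "x \<in> ev u" for x
  proof -
    from that obtain m where "comb u {..<m} True x" using comb_finite_index ev_iff by blast
    hence "D True x" using D_comb u by blast
    thus "A x" by (simp add: D_def)
  qed
  ultimately show ?thesis by blast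
qed

lemma pigeonhole:
  assumes v: "v \<in> seqs"
  shows "\<exists>u. u \<preceq> v \<and> ((\<forall>x\<in>ev u. A x) \<or> (\<forall>x\<in>ev u. \<not> A x))"
proof -
  obtain q e where q: "ultra q" "q \<le> comb_filter v True" "ultra e" "e \<odot> e = e"
    "q \<odot> q = q" "e \<odot> q = q" "q \<odot> e = q"
    "\<And>r i. 1 \<le> r \<Longrightarrow> r \<le> k (Suc i) \<Longrightarrow> filtermap (subst r) q = e"
    using variable_idempotent[OF v] by metis
  have "eventually A q \<or> eventually (\<lambda>x. \<not> A x) q" using q(1) by (simp add: ultra_def)
  moreover have "\<exists>u. u \<preceq> v \<and> (\<forall>x\<in>ev u. B x)" if "eventually B q" for B
    using v q(1-7) by (rule pigeonhole_ultra) (use q(8) that in auto)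
  ultimately show ?thesis by blast
qed

section \<open>Fusion\<close>

lemma Min_dom_less_iff: "x \<in> words \<Longrightarrow> m < Min (dom x) \<longleftrightarrow> before {m} (dom x)"
  using words_dom[of x] by (auto simp: before_def Min_gr_iff)

lemma after_iff:
  "x \<in> words \<Longrightarrow> after s x \<longleftrightarrow> s = [] \<or> before {Max (dom (last s))} (dom x)"
  by (simp add: after_def word_less_def Min_dom_less_iff)

lemma word_less_trans:
  "x \<in> words \<Longrightarrow> y \<in> words \<Longrightarrow> z \<in> words \<Longrightarrow> word_less x y \<Longrightarrow> word_less y z \<Longrightarrow> word_less x z"
  using before_trans[of "dom x" "dom y" "dom z"] words_dom(2)[of y] by (simp add: word_less_iff)

lemma word_less_irrefl: "x \<in> words \<Longrightarrow> \<not> word_less x x"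
  by (metis beforeD ex_in_conv less_irrefl word_less_iff words_dom(2))

lemma after_seqs_mono: "v \<in> seqs \<Longrightarrow> after s (v i) \<Longrightarrow> i \<le> j \<Longrightarrow> after s (v j)"
  using before_trans[OF _ seqs_less[of v i j], of "{Max (dom (last s))}"]
    words_dom(2)[OF seqs_words[of v i]]
  by (cases "i = j") (auto simp: after_iff seqs_words)

lemma after_eventually:
  assumes "v \<in> seqs" "s = [] \<or> Max (dom (last s)) \<le> i"
  shows "after s (v i)"
proof -
  have "before {i} (dom (v i))" using seqs_dom_ge[OF assms(1), of _ i] unfolding before_def by blast
  hence "before {Max (dom (last s))} (dom (v i))" if "s \<noteq> []"
    by (rule before_bound[rotated]) (use assms that in auto)
  thus ?thesis using assms(1) by (auto simp: after_iff seqs_words)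
qed

lemma seqs_shift: "v \<in> seqs \<Longrightarrow> v \<circ> (+) n \<in> seqs"
  by (rule seqs_subseq) (auto simp: strict_mono_def)

lemma prec_shift: "v \<in> seqs \<Longrightarrow> v \<circ> (+) n \<preceq> v"
  by (rule prec_subseq) (auto simp: strict_mono_def)

lemma prec_le_shift: "u \<preceq> v \<Longrightarrow> v \<in> seqs \<Longrightarrow> u \<circ> (+) n \<preceq> v"
  using prec_trans prec_shift prec_seqs by blast

lemma evfin_snoc:
  assumes "v \<in> seqs"
  shows "s @ [x] \<in> evfin v \<longleftrightarrow> s \<in> evfin v \<and> x \<in> ev v \<and> after s x"
proof -
  have "(\<forall>y\<in>set s. word_less y x) \<longleftrightarrow> after s x"
    if s: "set s \<subseteq> words" "sorted_wrt word_less s" and x: "x \<in> words"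
  proof (cases s rule: rev_cases)
    case (snoc s' z)
    hence "word_less y x" if "word_less z x" "y \<in> set s" for y
      using that s x word_less_trans[of y z x] by (auto simp: sorted_wrt_append)
    thus ?thesis using snoc by (auto simp: after_def)
  qed (simp add: after_def)
  thus ?thesis using ev_words[OF assms]
    by (auto simp: EVfin_def Lfin_def sorted_wrt_append)
qed

lemma evfin_Cons:
  "x # s \<in> evfin v \<longleftrightarrow> x \<in> words \<and> x \<in> ev v \<and> s \<in> evfin v \<and> (\<forall>y\<in>set s. word_less x y)"
  by (auto simp: EVfin_def Lfin_def)

lemma evfin_map:
  assumes "v \<in> seqs" "y \<in> seqs" "\<And>i. m \<le> i \<Longrightarrow> i < n \<Longrightarrow> y i \<in> ev v"
  shows "map y [m..<n] \<in> evfin v"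
  using assms seqs_less[OF assms(2)]
  by (auto simp: EVfin_def Lfin_def seqs_words sorted_wrt_map word_less_iff
      intro!: sorted_wrt_mono_rel[OF _ sorted_wrt_upt])

lemma evfin_mono: "u \<preceq> v \<Longrightarrow> v \<in> seqs \<Longrightarrow> evfin u \<subseteq> evfin v"
  using prec_ev_mono by (auto simp: EVfin_def)

lemma finite_Lfin_subset:
  assumes "finite A"
  shows "finite {s \<in> Lfin \<alpha> \<upsilon> k. set s \<subseteq> A}"
proof -
  have "distinct s" if "set s \<subseteq> words" "sorted_wrt word_less s" for s
    using that word_less_irrefl by (induction s) auto
  hence "{s \<in> Lfin \<alpha> \<upsilon> k. set s \<subseteq> A} \<subseteq> {s. set s \<subseteq> A \<and> distinct s}"
    by (auto simp: Lfin_def)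
  thus ?thesis using finite_subset_distinct[OF assms] by (rule finite_subset)
qed

lemma comb_after:
  assumes u: "u \<in> seqs" and x: "comb u UNIV b x" and n: "before (dom (u n)) (dom x)"
  shows "comb u {Suc n..} b x"
proof -
  have "n < i" if "dom (u i) \<subseteq> dom x" for i
  proof -
    have "before (dom (u n)) (dom (u i))" using n that unfolding before_def by blast
    thus ?thesis by (simp add: seqs_less_iff[OF u])
  qed
  hence "{i \<in> UNIV. dom (u i) \<subseteq> dom x} \<subseteq> {Suc n..}" by (auto simp: Suc_le_eq)
  thus ?thesis using comb_mono comb_tight[OF x order.refl] by blast
qed

text \<open>At each stage the current sequence is thinned for the finitely many \<open>s\<close>
  formed from the terms chosen so far, and one of its terms is taken. The resulting \<open>u\<close>
  need not be below the stage sequences, as its early terms are older; only its tails are. Hence the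
  form of \<open>local\<close>, which compares just the words after \<open>s\<close>.\<close>

lemma fusion:
  assumes w: "w \<in> seqs"
    and dense: "\<And>s v. s \<in> Lfin \<alpha> \<upsilon> k \<Longrightarrow> v \<preceq> w \<Longrightarrow> \<exists>v'. v' \<preceq> v \<and> D s v'"
    and local: "\<And>s v v'. s \<in> Lfin \<alpha> \<upsilon> k \<Longrightarrow> v \<preceq> w \<Longrightarrow> v' \<preceq> w \<Longrightarrow> D s v \<Longrightarrow>
      (\<And>x. x \<in> ev v' \<Longrightarrow> after s x \<Longrightarrow> x \<in> ev v) \<Longrightarrow> D s v'"
  shows "\<exists>u. u \<preceq> w \<and> (\<forall>s\<in>evfin u. D s u)"
proof -
  have dense_finite: "\<exists>v'. v' \<preceq> v \<and> (\<forall>s\<in>S. D s v')"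
    if "finite S" "S \<subseteq> Lfin \<alpha> \<upsilon> k" "v \<preceq> w" for S v
    using that
  proof (induction S)
    case empty
    thus ?case using prec_refl prec_seqs by blast
  next
    case (insert s S)
    then obtain v1 where v1: "v1 \<preceq> v" "\<forall>s\<in>S. D s v1" by auto
    hence v1w: "v1 \<preceq> w" using insert.prems prec_trans w by blast
    then obtain v2 where v2: "v2 \<preceq> v1" "D s v2" using dense[of s v1] insert.prems by auto
    have "D s' v2" if "s' \<in> S" for s'
      using local[of s' v1 v2] that v1 v2 insert.prems v1w prec_trans[OF v2(1) v1w w]
        prec_ev_mono[OF v2(1)] prec_seqs[OF v1(1)] by blast
    thus ?case using v2 prec_trans[OF v2(1) v1(1)] prec_seqs[OF insert.prems(2)] by blast
  qed
  \<comment> \<open>the term at position \<open>n\<close> has index at least \<open>n\<close> in \<open>fst r\<close>, so that its substitution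
    parameters are admitted there\<close>
  define P where "P f n r \<longleftrightarrow> fst r \<preceq> w \<and> (\<forall>m<n. fst r \<preceq> fst (f m)) \<and>
    (\<forall>s\<in>Lfin \<alpha> \<upsilon> k. set s \<subseteq> {x. comb (\<lambda>i. snd (f i)) {..<n} True x} \<longrightarrow> D s (fst r)) \<and>
    (\<exists>j\<ge>n. snd r = fst r j) \<and> (\<forall>m<n. before (dom (snd (f m))) (dom (snd r)))"
    for f :: "nat \<Rightarrow> (nat \<Rightarrow> 'a word) \<times> 'a word" and n r
  have "\<exists>f. \<forall>n. P f n (f n)"
  proof (rule dependent_wellorder_choice)
    fix r n and f g :: "nat \<Rightarrow> (nat \<Rightarrow> 'a word) \<times> 'a word"
    assume fg: "\<And>y. y < n \<Longrightarrow> f y = g y"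
    hence "comb (\<lambda>i. snd (f i)) {..<n} b x \<longleftrightarrow> comb (\<lambda>i. snd (g i)) {..<n} b x" for b x
      using comb_cong[of "\<lambda>i. snd (f i)" "{..<n}" b x "\<lambda>i. snd (g i)"]
        comb_cong[of "\<lambda>i. snd (g i)" "{..<n}" b x "\<lambda>i. snd (f i)"] by auto
    thus "P f n r = P g n r" using fg by (simp add: P_def)
  next
    fix n f assume IH: "\<And>m. m < n \<Longrightarrow> P f m (f m)"
    define V0 where "V0 = (if n = 0 then w else fst (f (n - 1)))"
    have V0: "V0 \<preceq> w" using IH[of "n - 1"] prec_refl[OF w] by (auto simp: V0_def P_def)
    have V0_le: "V0 \<preceq> fst (f m)" if "m < n" for m
    proof (cases "m = n - 1")
      case True
      thus ?thesis using that V0 prec_refl prec_seqs by (auto simp: V0_def)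
    next
      case False
      thus ?thesis using that IH[of "n - 1"] by (auto simp: V0_def P_def)
    qed
    define A where "A = {x. comb (\<lambda>i. snd (f i)) {..<n} True x}"
    have "A \<subseteq> snd ` {(b, x). comb (\<lambda>i. snd (f i)) {..<n} b x}" by (force simp: A_def)
    hence "finite A" using finite_comb finite_surj by blast
    then obtain V where V: "V \<preceq> V0" "\<forall>s\<in>{s \<in> Lfin \<alpha> \<upsilon> k. set s \<subseteq> A}. D s V"
      using dense_finite[OF finite_Lfin_subset[of A] _ V0] by auto
    have Vs: "V \<in> seqs" using V prec_seqs by blast
    have fin: "finite (\<Union>m<n. dom (snd (f m)))"
    proof (intro finite_UN_I finite_lessThan)
      fix m assume "m \<in> {..<n}"
      hence "fst (f m) \<in> seqs" "\<exists>j. snd (f m) = fst (f m) j"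
        using IH[of m] prec_seqs by (auto simp: P_def)
      thus "finite (dom (snd (f m)))" using seqs_words words_dom(1) by metis
    qed
    \<comment> \<open>Every position in \<open>V j\<close> exceeds \<open>j\<close>, so bounding the
      earlier positions by \<open>j\<close> puts the new term beyond its predecessors.\<close>
    define j where "j = Max (insert n (\<Union>m<n. dom (snd (f m))))"
    have j: "i \<le> j" if "i \<in> insert n (\<Union>m<n. dom (snd (f m)))" for i
      unfolding j_def using that fin by (intro Max_ge) auto
    have "before {j} (dom (V j))" using seqs_dom_ge[OF Vs, of _ j] unfolding before_def by blast
    hence "before (dom (snd (f m))) (dom (V j))" if "m < n" for m
      by (rule before_bound[rotated]) (use j that in auto)
    moreover have "fst (V, V j) \<preceq> w" using prec_trans[OF V(1) V0 w] by simp
    moreover have "\<forall>m<n. fst (V, V j) \<preceq> fst (f m)"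
    proof safe
      fix m assume "m < n"
      hence "fst (f m) \<in> seqs" using IH[of m] prec_seqs by (auto simp: P_def)
      thus "fst (V, V j) \<preceq> fst (f m)" using prec_trans[OF V(1) V0_le[OF \<open>m < n\<close>]] by simp
    qed
    ultimately have "P f n (V, V j)" using V(2) j[of n] by (auto simp: P_def A_def)
    thus "\<exists>r. P f n r" by blast
  qed
  then obtain f where f: "\<And>n. P f n (f n)" by blast
  define V where "V n = fst (f n)" for n
  define u where "u n = snd (f n)" for n
  have Vw: "V n \<preceq> w" and VV: "m < n \<Longrightarrow> V n \<preceq> V m"
    and DV: "s \<in> Lfin \<alpha> \<upsilon> k \<Longrightarrow> set s \<subseteq> {x. comb u {..<n} True x} \<Longrightarrow> D s (V n)"
    and uV: "\<exists>j\<ge>n. u n = V n j" and uu: "m < n \<Longrightarrow> before (dom (u m)) (dom (u n))" for m n s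
    using f[of n] by (auto simp: P_def V_def u_def[abs_def])
  have Vs: "V n \<in> seqs" for n using Vw prec_seqs by blast
  have "u n \<in> words" for n using uV[of n] Vs seqs_words by metis
  hence u: "u \<in> seqs" using uu by (simp add: Linf_def word_less_iff)
  have "u n \<in> ev w" for n using uV[of n] Vw[of n] by (auto simp: prec_def)
  hence uw: "u \<preceq> w" using u by (simp add: prec_def)
  have u_comb: "comb (V n) {i..} True (u i)" if "n \<le> i" for n i
  proof -
    obtain j where j: "j \<ge> i" "u i = V i j" using uV by blast
    have "V i \<preceq> V n" using VV[of n i] prec_refl[OF Vs] that by (cases "n = i") auto
    hence "comb (V n) {j..} True (u i)" using prec_comb Vs j by simp
    thus ?thesis by (rule comb_mono) (use j in auto)
  qed
  have "D s u" if s: "s \<in> evfin u" for s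
  proof -
    have sL: "s \<in> Lfin \<alpha> \<upsilon> k" and sev: "set s \<subseteq> ev u" using s by (auto simp: EVfin_def)
    have sw: "x \<in> words" if "x \<in> set s" for x using sL that by (auto simp: Lfin_def)
    have "\<exists>n. comb u {..<n} True x" if "x \<in> set s" for x
      using sev that comb_finite_index ev_iff by blast
    then obtain N where N: "\<And>x. x \<in> set s \<Longrightarrow> comb u {..<N x} True x" by metis
    have "\<exists>n. \<forall>x\<in>set s. comb u {..<n} True x"
    proof (intro exI ballI)
      fix x assume "x \<in> set s"
      thus "comb u {..<Max (N ` set s)} True x"
        by (intro comb_mono[OF N]) (auto intro: less_le_trans)
    qed
    \<comment> \<open>With the least \<open>n\<close>, if \<open>n = Suc m\<close>, some word of
      \<open>s\<close> uses \<open>u m\<close>. A word after \<open>s\<close> then lies beyond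
      \<open>u m\<close>, so it combines terms with indices from \<open>n\<close> on, and these all
      come from \<open>V n\<close>.\<close>
    define n where "n = (LEAST n. \<forall>x\<in>set s. comb u {..<n} True x)"
    have n: "\<forall>x\<in>set s. comb u {..<n} True x"
      unfolding n_def by (rule LeastI_ex) fact
    have min: "\<exists>x\<in>set s. \<not> comb u {..<m} True x" if "m < n" for m
      using not_less_Least[of m "\<lambda>n. \<forall>x\<in>set s. comb u {..<n} True x"] that
      unfolding n_def by blast
    show ?thesis
    proof (rule local[OF sL Vw uw])
      show "D s (V n)" using DV[OF sL] n by auto
      fix x assume x: "x \<in> ev u" "after s x"
      hence xw: "x \<in> words" using ev_words u by blast
      have "comb u {n..} True x"
      proof (cases n)
        case 0
        thus ?thesis using x by (auto simp: ev_iff intro: comb_mono)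
      next
        case (Suc m)
        then obtain y where y: "y \<in> set s" "\<not> comb u {..<m} True y" using min[of m] by auto
        have "\<not> {i \<in> {..<n}. dom (u i) \<subseteq> dom y} \<subseteq> {..<m}"
          using comb_mono[OF comb_tight[of u "{..<n}" True y "dom y"]] n y by blast
        then obtain i where "i < n" "dom (u i) \<subseteq> dom y" "\<not> i < m" by auto
        moreover from this have "i = m" using Suc by simp
        ultimately have um: "dom (u m) \<subseteq> dom y" by simp
        have yl: "y = last s \<or> word_less y (last s)"
          using y(1) sL by (cases s rule: rev_cases) (auto simp: Lfin_def sorted_wrt_append)
        have "s \<noteq> []" using y(1) by auto
        hence ls: "last s \<in> words" "s \<noteq> []" using sw by simp_all
        hence "word_less (last s) x" using x(2) by (simp add: after_def)
        hence "word_less y x" using yl word_less_trans[OF sw[OF y(1)] ls(1) xw] by blast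
        hence "before (dom y) (dom x)" using sw[OF y(1)] xw by (simp add: word_less_iff)
        hence "before (dom (u m)) (dom x)" using um unfolding before_def by blast
        thus ?thesis using comb_after[OF u] x(1) Suc by (simp add: ev_iff)
      qed
      hence "comb (V n) UNIV True x" using u Vs u_comb by (rule comb_trans) auto
      thus "x \<in> ev (V n)" by (simp add: ev_iff)
    qed
  qed
  thus ?thesis using uw by blast
qed

end

section \<open>Ranks of the Schreier families\<close>

text \<open>\<open>large \<rho> H\<close> bounds the Cantor--Bendixson rank of \<open>H\<close> from below along every sufficiently
  sparse set.  It says that all members of \<open>H\<close> are long, so it is antitone in \<open>H\<close>.\<close>

definition link :: "(nat set \<Rightarrow> bool) \<Rightarrow> nat \<Rightarrow> nat set \<Rightarrow> bool" where
  "link H n S \<longleftrightarrow> before {n} S \<and> H (insert n S)"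

inductive large :: "omega1 \<Rightarrow> (nat set \<Rightarrow> bool) \<Rightarrow> bool" where
  large: "(\<And>\<sigma>. \<sigma> < \<rho> \<Longrightarrow> \<not> H {} \<and> (\<exists>N. \<forall>n\<ge>N. large \<sigma> (link H n))) \<Longrightarrow> large \<rho> H"

lemma large_iff:
  "large \<rho> H \<longleftrightarrow> (\<forall>\<sigma><\<rho>. \<not> H {} \<and> (\<exists>N. \<forall>n\<ge>N. large \<sigma> (link H n)))"
  by (subst large.simps) blast

lemma large_mono: "large \<rho> H \<Longrightarrow> \<sigma> \<le> \<rho> \<Longrightarrow> large \<sigma> H"
  by (subst (asm) large_iff, subst large_iff) (meson less_le_trans)

lemma large_antimono: "large \<rho> H \<Longrightarrow> H' \<le> H \<Longrightarrow> large \<rho> H'"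
proof (induction \<rho> arbitrary: H H' rule: less_induct)
  case (less \<rho>)
  have "link H' n \<le> link H n" for n using less.prems(2) by (auto simp: link_def)
  hence "large \<sigma> (link H n) \<Longrightarrow> \<sigma> < \<rho> \<Longrightarrow> large \<sigma> (link H' n)" for \<sigma> n
    using less.IH by blast
  thus ?case using less.prems large_iff[of \<rho> H] large_iff[of \<rho> H'] by blast
qed

text \<open>The thresholds combine by maximum. This absorbs the two ways in which a minimum can be
  removed from a set ending in \<open>H\<close>.\<close>

lemma large_sup: "large \<rho> H \<Longrightarrow> large \<rho> K \<Longrightarrow> large \<rho> (\<lambda>S. H S \<or> K S)"
proof (induction \<rho> arbitrary: H K rule: less_induct)
  case (less \<rho>)
  show ?case
  proof (subst large_iff, intro allI impI conjI)
    fix \<sigma> assume \<sigma>: "\<sigma> < \<rho>"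
    obtain M N where MN: "\<And>n. n \<ge> M \<Longrightarrow> large \<sigma> (link H n)" "\<And>n. n \<ge> N \<Longrightarrow> large \<sigma> (link K n)"
      and "\<not> H {}" "\<not> K {}"
      using less.prems[unfolded large_iff[of \<rho>]] \<sigma> by blast
    thus "\<not> (H {} \<or> K {})" by simp
    have "link (\<lambda>S. H S \<or> K S) n = (\<lambda>S. link H n S \<or> link K n S)" for n
      by (auto simp: link_def)
    thus "\<exists>N. \<forall>n\<ge>N. large \<sigma> (link (\<lambda>S. H S \<or> K S) n)"
      using less.IH[OF \<sigma>] MN by (intro exI[of _ "max M N"]) auto
  qed
qed

lemma large_0: "large 0 H"
  using not_less_Least[of _ "\<lambda>_. True"] by (subst large_iff) (auto simp: zero_omega1_def)

lemma large_none: "large \<rho> (\<lambda>_. False)"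
proof (induction \<rho> rule: less_induct)
  case (less \<rho>)
  have "link (\<lambda>_. False) n = (\<lambda>_. False)" for n by (auto simp: link_def)
  thus ?case using less by (subst large_iff) auto
qed

text \<open>An arbitrary earlier part is allowed because later arguments control only the last block
  of a Schreier set.\<close>

definition ends_in :: "(nat set \<Rightarrow> bool) \<Rightarrow> nat set \<Rightarrow> bool" where
  "ends_in H S \<longleftrightarrow> (\<exists>A B. before A B \<and> H B \<and> S = A \<union> B)"

text \<open>Removing the minimum \<open>n\<close> of \<open>A \<union> B\<close> leaves a set ending
  in \<open>H\<close> if \<open>n\<close> is in \<open>A\<close>; otherwise \<open>A\<close> is
  empty and a member of \<open>link H n\<close> remains. Both families are large for the smaller
  ordinal.\<close>

lemma large_ends_in: "large \<rho> H \<Longrightarrow> large \<rho> (ends_in H)"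
proof (induction \<rho> arbitrary: H rule: less_induct)
  case (less \<rho>)
  show ?case
  proof (subst large_iff, intro allI impI conjI)
    fix \<sigma> assume \<sigma>: "\<sigma> < \<rho>"
    then obtain N where N: "\<And>n. n \<ge> N \<Longrightarrow> large \<sigma> (link H n)" and H: "\<not> H {}"
      using less.prems[unfolded large_iff[of \<rho>]] by blast
    show "\<not> ends_in H {}" using H by (auto simp: ends_in_def)
    have "large \<sigma> (ends_in H)" using less.IH[OF \<sigma>] large_mono[OF less.prems] \<sigma> by simp
    hence "large \<sigma> (\<lambda>S. ends_in H S \<or> link H n S)" if "n \<ge> N" for n
      using N[OF that] by (rule large_sup)
    moreover have "link (ends_in H) n \<le> (\<lambda>S. ends_in H S \<or> link H n S)" for n
    proof (rule le_funI)
      fix S show "link (ends_in H) n S \<le> (ends_in H S \<or> link H n S)"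
      proof (rule le_boolI)
        assume "link (ends_in H) n S"
        then obtain A B where AB: "before {n} S" "before A B" "H B" "insert n S = A \<union> B"
          by (auto simp: link_def ends_in_def)
        have nS: "n \<notin> S" using AB(1) by (auto simp: before_def)
        show "ends_in H S \<or> link H n S"
        proof (cases "n \<in> A")
          case True
          hence "n \<notin> B" using AB(2) by (auto simp: before_def)
          hence "S = (A - {n}) \<union> B" using AB(4) nS True by auto
          moreover have "before (A - {n}) B" using AB(2) by (auto simp: before_def)
          ultimately show ?thesis using AB(3) unfolding ends_in_def by blast
        next
          case False
          hence n: "n \<in> B" using AB(4) by auto
          have "a \<notin> A" for a
          proof
            assume a: "a \<in> A"
            have "a < n" by (rule beforeD[OF AB(2) a n])
            moreover have "a \<in> S" using a False AB(4) by auto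
            hence "n < a" using AB(1) by (auto simp: before_def)
            ultimately show False by simp
          qed
          hence "B = insert n S" using AB(4) by auto
          thus ?thesis using AB by (simp add: link_def)
        qed
      qed
    qed
    ultimately show "\<exists>N. \<forall>n\<ge>N. large \<sigma> (link (ends_in H) n)"
      using large_antimono by blast
  qed
qed

section \<open>Arithmetic of countable ordinals\<close>

lemma less_osuc: "a < osuc a"
proof -
  obtain b where "a < b" using countable_omega1_bounded[of "{a}"] by auto
  thus ?thesis unfolding osuc_def by (rule LeastI)
qed

lemma osuc_le_iff: "osuc a \<le> b \<longleftrightarrow> a < b"
  using less_osuc[of a] by (auto simp: osuc_def intro: Least_le)

lemma less_osuc_iff: "a < osuc b \<longleftrightarrow> a \<le> b"
  using osuc_le_iff[of b a] by (metis not_le)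

lemma osuc_inject: "osuc a = osuc b \<Longrightarrow> a = b"
  by (metis less_osuc less_osuc_iff antisym)

lemma omega1_0_le: "(0 :: omega1) \<le> a"
  unfolding zero_omega1_def by (rule Least_le) simp

lemma osuc_neq_0: "osuc a \<noteq> 0"
  using less_osuc[of a] omega1_0_le[of a] by auto

lemma one_le_iff: "(1 :: omega1) \<le> a \<longleftrightarrow> 0 < a"
  by (simp add: one_omega1_def osuc_le_iff)

lemma oadd_props: "a \<le> oadd a b" "c < b \<Longrightarrow> oadd a c < oadd a b"
proof -
  have "countable (insert a (oadd a ` {..<b}))" using countable_lessThan_omega1 by simp
  then obtain d where "\<forall>x\<in>insert a (oadd a ` {..<b}). x < d"
    using countable_omega1_bounded by blast
  hence "a \<le> d \<and> (\<forall>b'\<in>{..<b}. oadd a b' < d)" by auto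
  hence "a \<le> oadd a b \<and> (\<forall>b'\<in>{..<b}. oadd a b' < oadd a b)"
    unfolding oadd.simps[of a b] by (rule LeastI)
  thus "a \<le> oadd a b" "c < b \<Longrightarrow> oadd a c < oadd a b" by auto
qed

lemma le_oadd: "b \<le> oadd a b"
proof (induction b rule: less_induct)
  case (less b)
  show ?case
  proof (rule ccontr)
    assume "\<not> b \<le> oadd a b"
    hence "oadd a b < b" by simp
    thus False using less[of "oadd a b"] oadd_props(2)[of "oadd a b" b a] by simp
  qed
qed

lemma omega_pow_props:
  "1 \<le> omega_pow b" "b' < b \<Longrightarrow> omul_nat (omega_pow b') n \<le> omega_pow b"
proof -
  have "countable (insert 1 (\<Union>b'\<in>{..<b}. range (omul_nat (omega_pow b'))))"
    using countable_lessThan_omega1 by simp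
  then obtain c where "\<forall>x\<in>insert 1 (\<Union>b'\<in>{..<b}. range (omul_nat (omega_pow b'))). x < c"
    using countable_omega1_bounded by blast
  hence "1 \<le> c \<and> (\<forall>b'\<in>{..<b}. \<forall>n. omul_nat (omega_pow b') n \<le> c)"
    by (auto intro!: less_imp_le)
  hence "1 \<le> omega_pow b \<and> (\<forall>b'\<in>{..<b}. \<forall>n. omul_nat (omega_pow b') n \<le> omega_pow b)"
    unfolding omega_pow.simps[of b] by (rule LeastI)
  thus "1 \<le> omega_pow b" "b' < b \<Longrightarrow> omul_nat (omega_pow b') n \<le> omega_pow b" by auto
qed

lemma omul_nat_Suc_less: "omul_nat (omega_pow b) n < omul_nat (omega_pow b) (Suc n)"
proof -
  have "omul_nat (omega_pow b) n \<le> oadd (omul_nat (omega_pow b) n) 0" by (rule oadd_props)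
  also have "\<dots> < oadd (omul_nat (omega_pow b) n) (omega_pow b)"
    by (rule oadd_props) (use omega_pow_props(1)[of b] in \<open>simp add: one_le_iff\<close>)
  finally show ?thesis by simp
qed

lemma omega_pow_less: "a < b \<Longrightarrow> omega_pow a < omega_pow b"
proof -
  assume "a < b"
  have "omega_pow a \<le> omul_nat (omega_pow a) 1" using le_oadd by simp
  also have "\<dots> < omul_nat (omega_pow a) 2"
    using omul_nat_Suc_less[of a 1] by (simp add: numeral_2_eq_2)
  also have "\<dots> \<le> omega_pow b" using \<open>a < b\<close> by (rule omega_pow_props)
  finally show ?thesis .
qed

lemma omega_pow_less_iff: "omega_pow a < omega_pow b \<longleftrightarrow> a < b"
  using omega_pow_less by (metis less_asym less_irrefl linorder_less_linear)

lemma omega_pow_le_iff: "omega_pow a \<le> omega_pow b \<longleftrightarrow> a \<le> b"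
  using omega_pow_less_iff[of b a] by (metis not_le)

lemma omega_pow_eq_iff: "omega_pow a = omega_pow b \<longleftrightarrow> a = b"
  using omega_pow_le_iff by (metis antisym order.refl)

lemma omega_pow_neq_0: "omega_pow a \<noteq> 0"
  using omega_pow_props(1)[of a] by (auto simp: one_le_iff)

text \<open>Otherwise \<open>\<zeta>\<close> would already satisfy the defining bounds: each
  multiple of a smaller power is strictly below the next multiple, hence at most
  \<open>\<zeta>\<close>.\<close>

lemma omega_pow_not_osuc:
  assumes "0 < a"
  shows "omega_pow a \<noteq> osuc \<zeta>"
proof
  assume eq: "omega_pow a = osuc \<zeta>"
  have le: "omul_nat (omega_pow b) n \<le> \<zeta>" if "b < a" for b n
    using omul_nat_Suc_less[of b n] omega_pow_props(2)[OF that, of "Suc n"] eq less_osuc_iff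
    by (metis less_le_trans)
  have "1 \<le> omul_nat (omega_pow 0) 1" using omega_pow_props(1) le_oadd order.trans by fastforce
  hence "1 \<le> \<zeta>" using le[OF assms, of 1] by simp
  hence "omega_pow a \<le> \<zeta>" unfolding omega_pow.simps[of a] using le by (intro Least_le) auto
  thus False using eq less_osuc[of \<zeta>] by simp
qed

section \<open>Blocks and lower rank bounds of the Schreier families\<close>

lemma union_of_successive_ends_in:
  assumes "union_of_successive p F s" "0 < p"
  shows "ends_in F s"
proof -
  obtain ss where ss: "length ss = p" "sorted_wrt before ss" "\<forall>x\<in>set ss. F x" "s = \<Union>(set ss)"
    using assms(1) by (auto simp: union_of_successive_def)
  then obtain ss' x where "ss = ss' @ [x]" using assms(2) by (cases ss rule: rev_cases) auto
  hence "before (\<Union>(set ss')) x" "F x" "s = \<Union>(set ss') \<union> x"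
    using ss by (auto simp: sorted_wrt_append before_def)
  thus ?thesis unfolding ends_in_def by blast
qed

text \<open>Removing its minimum from a union of at least two successive sets spoils only the first
  of them.\<close>

lemma union_of_successive_link:
  assumes "union_of_successive p F (insert n s)" "2 \<le> p" "before {n} s" "\<not> F {}"
  shows "ends_in F s"
proof -
  obtain A B where AB: "before A B" "F B" "insert n s = A \<union> B" "A \<noteq> {}"
  proof -
    obtain ss where ss: "length ss = p" "sorted_wrt before ss" "\<forall>x\<in>set ss. F x"
        "insert n s = \<Union>(set ss)"
      using assms(1) by (auto simp: union_of_successive_def)
    then obtain ss' x where x: "ss = ss' @ [x]" using assms(2) by (cases ss rule: rev_cases) auto
    hence "ss' \<noteq> []" using ss(1) assms(2) by auto
    then obtain y where "y \<in> set ss'" by (cases ss') auto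
    hence "y \<noteq> {}" "y \<subseteq> \<Union>(set ss')" using ss(3) x assms(4) by auto
    hence "\<Union>(set ss') \<noteq> {}" by auto
    moreover have "before (\<Union>(set ss')) x" "F x" "insert n s = \<Union>(set ss') \<union> x"
      using ss x by (auto simp: sorted_wrt_append before_def)
    ultimately show ?thesis using that by blast
  qed
  have n: "n \<notin> B"
  proof
    assume "n \<in> B"
    obtain a where a: "a \<in> A" using AB(4) by blast
    hence "a < n" using AB(1) \<open>n \<in> B\<close> by (simp add: before_def)
    moreover have "a = n \<or> n < a" using a AB(3) assms(3) by (auto simp: before_def)
    ultimately show False by auto
  qed
  have "n \<notin> s" using assms(3) by (auto simp: before_def)
  hence "s = (A - {n}) \<union> B" using AB(3) n by auto
  moreover have "before (A - {n}) B" using AB(1) by (auto simp: before_def)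
  ultimately show ?thesis using AB(2) unfolding ends_in_def by blast
qed

text \<open>For a positive exponent the power is no successor, and it never lies strictly between
  \<open>omega_pow \<alpha>\<close> and \<open>omega_pow (osuc \<alpha>)\<close>, so only the two
  power clauses remain.\<close>

lemma schreier_omega_pow_cases:
  assumes "schreier lam (omega_pow a) s" "0 < a"
  obtains (succ) \<beta> where "a = osuc \<beta>" "s \<noteq> {}"
      "union_of_successive (Min s) (schreier lam (omega_pow \<beta>)) s"
    | (limit) "is_limit a" "s \<noteq> {}" "schreier lam (omega_pow (lam a (Min s))) s"
  using assms(1)
proof (cases rule: schreier.cases)
  case one
  thus ?thesis using omega_pow_not_osuc[OF assms(2), of 0] by (simp add: one_omega1_def)
next
  case (sum ts \<alpha> p ts' ss)
  from sum(4,5) have "\<alpha> < a" "a < osuc \<alpha>" by (simp_all only: omega_pow_less_iff)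
  thus ?thesis by (simp add: less_osuc_iff)
qed (use assms(2) omega_pow_neq_0 omega_pow_not_osuc that in \<open>auto simp: omega_pow_eq_iff\<close>)

text \<open>Every clause but \<open>zero\<close> contributes an element; in \<open>sum\<close> it
  comes from the leading block, whose multiplicity \<open>p\<close> is positive.\<close>

lemma schreier_empty: "schreier lam \<xi> {} \<Longrightarrow> \<xi> = 0"
proof -
  have "\<xi> \<noteq> 0 \<Longrightarrow> s \<noteq> {}" if "schreier lam \<xi> s" for s
    using that
  proof (induction rule: schreier.induct)
    case (sum \<xi> ts \<alpha> p ts' ss s)
    have "0 < length ts" "0 < length ss" using sum.hyps by auto
    obtain xs where xs: "length xs = p" "\<forall>x\<in>set xs. (omega_pow \<alpha> \<noteq> 0 \<longrightarrow> x \<noteq> {})" "ss ! 0 = \<Union>(set xs)"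
      using sum.IH sum.hyps(2) by (fastforce simp: union_of_successive_def)
    have "0 < p" using sum.hyps by auto
    then obtain x where "x \<in> set xs" using xs(1) by (cases xs) auto
    hence "x \<noteq> {}" "x \<subseteq> ss ! 0" using xs omega_pow_neq_0 by auto
    moreover have "ss ! 0 \<in> set ss" using \<open>0 < length ss\<close> by simp
    ultimately show ?case using sum.hyps(10) by auto
  qed auto
  thus "schreier lam \<xi> {} \<Longrightarrow> \<xi> = 0" by blast
qed

lemma schreier_finite: "schreier lam \<xi> s \<Longrightarrow> finite s"
proof (induction rule: schreier.induct)
  case (sum \<xi> ts \<alpha> p ts' ss s)
  have "finite x" if "x \<in> set ss" for x
    using that sum.IH sum.hyps(8) by (fastforce simp: in_set_conv_nth union_of_successive_def)
  thus ?case using sum.hyps by auto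
qed (auto simp: union_of_successive_def)

lemma large_schreier_omega_pow:
  assumes lam: "fundamental_sequences lam"
  shows "large a (schreier lam (omega_pow a))"
proof (induction a rule: less_induct)
  case (less a)
  show ?case
  proof (subst large_iff, intro allI impI conjI)
    fix \<sigma> assume \<sigma>: "\<sigma> < a"
    hence a: "0 < a" using omega1_0_le le_less_trans by blast
    show "\<not> schreier lam (omega_pow a) {}" using schreier_empty omega_pow_neq_0 by blast
    \<comment> \<open>Both kinds of \<open>a\<close> are treated together: terms of a fundamental
      sequence are successors, so at a limit the minimum \<open>n\<close> selects an exponent
      \<open>osuc \<gamma>\<close>. The set then consists of \<open>n\<close> blocks at
      \<open>omega_pow \<gamma>\<close>, and \<open>n \<ge> 2\<close> leaves the last one
      intact.\<close>
    have link: "link (schreier lam (omega_pow a)) n \<le> ends_in (schreier lam (omega_pow \<gamma>))"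
      if n: "2 \<le> n" and \<gamma>: "a = osuc \<gamma> \<or> is_limit a \<and> lam a n = osuc \<gamma>" for n \<gamma>
    proof (rule le_funI)
      fix S
      show "link (schreier lam (omega_pow a)) n S \<le> ends_in (schreier lam (omega_pow \<gamma>)) S"
      proof (rule le_boolI)
        assume S: "link (schreier lam (omega_pow a)) n S"
        hence nS: "before {n} S" by (simp add: link_def)
        have M: "Min (insert n S) = n" if "finite S"
          using nS that by (intro Min_eqI) (auto simp: before_def)
        have S': "schreier lam (omega_pow a) (insert n S)" using S by (simp add: link_def)
        hence "finite S" using schreier_finite by fastforce
        hence Min: "Min (insert n S) = n" by (rule M)
        have emp: "\<not> schreier lam (omega_pow \<gamma>) {}" using schreier_empty omega_pow_neq_0 by blast
        have pos: "0 < osuc \<gamma>"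
          using osuc_neq_0[of \<gamma>] omega1_0_le[of "osuc \<gamma>"] by (simp add: order.order_iff_strict)
        have osuc: "union_of_successive n (schreier lam (omega_pow \<gamma>)) (insert n S)"
          if "schreier lam (omega_pow (osuc \<gamma>)) (insert n S)"
          using that pos
        proof (cases rule: schreier_omega_pow_cases)
          case (succ \<beta>)
          thus ?thesis using Min osuc_inject by metis
        qed (auto simp: is_limit_def)
        have "schreier lam (omega_pow (osuc \<gamma>)) (insert n S)"
          using S' a
        proof (cases rule: schreier_omega_pow_cases)
          case (succ \<beta>)
          thus ?thesis using \<gamma> S' by (auto simp: is_limit_def)
        next
          case limit
          thus ?thesis using \<gamma> Min by (auto simp: is_limit_def)
        qed
        thus "ends_in (schreier lam (omega_pow \<gamma>)) S"
          using osuc union_of_successive_link n nS emp by blast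
      qed
    qed
    show "\<exists>N. \<forall>n\<ge>N. large \<sigma> (link (schreier lam (omega_pow a)) n)"
    proof (cases "is_limit a")
      case True
      hence l: "\<And>n. n \<ge> 1 \<Longrightarrow> lam a n < a \<and> (\<exists>b. lam a n = osuc b)" "mono_on {1..} (lam a)"
        "\<exists>n\<ge>1. \<sigma> < lam a n"
        using lam \<sigma> by (auto simp: fundamental_sequences_def)
      then obtain N where N: "1 \<le> N" "\<sigma> < lam a N" by blast
      have "large \<sigma> (link (schreier lam (omega_pow a)) n)" if n: "n \<ge> max 2 N" for n
      proof -
        obtain \<gamma> where \<gamma>: "lam a n = osuc \<gamma>" "lam a n < a" using l(1)[of n] n by auto
        have "\<sigma> < osuc \<gamma>" using N(2) mono_onD[OF l(2), of N n] N(1) n \<gamma>(1) by auto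
        hence "\<sigma> \<le> \<gamma>" by (simp add: less_osuc_iff)
        moreover have "\<gamma> < a" using \<gamma> less_osuc[of \<gamma>] by auto
        ultimately have "large \<sigma> (ends_in (schreier lam (omega_pow \<gamma>)))"
          using less.IH large_mono large_ends_in by blast
        thus ?thesis using link[of n \<gamma>] n True \<gamma> large_antimono by auto
      qed
      thus ?thesis by blast
    next
      case False
      then obtain \<gamma> where \<gamma>: "a = osuc \<gamma>" using a by (auto simp: is_limit_def)
      hence "\<sigma> \<le> \<gamma>" "\<gamma> < a" using \<sigma> less_osuc by (auto simp: less_osuc_iff)
      hence "large \<sigma> (ends_in (schreier lam (omega_pow \<gamma>)))"
        using less.IH large_mono large_ends_in by blast
      hence "\<forall>n\<ge>2. large \<sigma> (link (schreier lam (omega_pow a)) n)"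
        using link \<gamma> large_antimono by blast
      thus ?thesis by blast
    qed
  qed
qed

text \<open>A weak form of the fact that \<open>\<A>\<^sub>\<xi>\<close> has rank \<open>\<xi>\<close>.  It needs only the last block of the
  sets in the clause \<open>sum\<close>, hence no uniqueness of Cantor normal forms.\<close>

lemma large_schreier:
  assumes lam: "fundamental_sequences lam"
  shows "omega_pow a \<le> \<xi> \<Longrightarrow> large a (schreier lam \<xi>)"
proof (induction \<xi> rule: less_induct)
  case (less \<xi>)
  show ?case
  proof (cases "0 < a")
    case False
    thus ?thesis using large_0 omega1_0_le[of a] by auto
  next
    case a: True
    have \<xi>0: "\<xi> \<noteq> 0" using less.prems omega_pow_props(1)[of a] by (auto simp: one_le_iff)
    consider (osuc) \<zeta> where "\<xi> = osuc \<zeta>" | (pow) b where "\<xi> = omega_pow b"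
      | (limit) "is_limit \<xi>" "\<And>b. \<xi> \<noteq> omega_pow b"
      using \<xi>0 by (auto simp: is_limit_def)
    thus ?thesis
    proof cases
      case (osuc \<zeta>)
      \<comment> \<open>The bound on \<open>\<xi>\<close> therefore passes to
        \<open>\<zeta>\<close>, and a member at \<open>osuc \<zeta>\<close> without its minimum is a
        member at \<open>\<zeta>\<close>.\<close>
      have "omega_pow a \<noteq> osuc \<zeta>" by (rule omega_pow_not_osuc[OF a])
      hence le: "omega_pow a \<le> \<zeta>" using less.prems osuc by (simp add: order.order_iff_strict less_osuc_iff)
      hence "large a (ends_in (schreier lam \<zeta>))" using less.IH osuc less_osuc large_ends_in by blast
      moreover have "schreier lam \<xi> \<le> ends_in (schreier lam \<zeta>)"
      proof (rule le_funI)
        fix s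
        show "schreier lam \<xi> s \<le> ends_in (schreier lam \<zeta>) s"
        proof (rule le_boolI)
          have *: "\<zeta> \<noteq> 0" using le omega_pow_props(1)[of a] by (auto simp: one_le_iff)
          assume "schreier lam \<xi> s"
          thus "ends_in (schreier lam \<zeta>) s"
          proof (cases rule: schreier.cases)
            case (succ n s' \<zeta>')
            hence "\<zeta>' = \<zeta>" using osuc osuc_inject by simp
            thus ?thesis using succ unfolding ends_in_def by blast
          next
            case one
            thus ?thesis using * osuc osuc_inject by (auto simp: one_omega1_def)
          next
            case (pow_succ \<beta>)
            have "0 < osuc \<beta>" using osuc_neq_0 omega1_0_le[of "osuc \<beta>"] by (auto simp: order.order_iff_strict)
            thus ?thesis using pow_succ omega_pow_not_osuc[of "osuc \<beta>" \<zeta>] osuc by simp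
          next
            case (pow_limit l)
            hence "0 < l" using omega1_0_le[of l] by (auto simp: is_limit_def order.order_iff_strict)
            thus ?thesis using pow_limit omega_pow_not_osuc[of l \<zeta>] osuc by simp
          next
            case (sum ts \<alpha> p ts' ss)
            thus ?thesis using osuc by (metis is_limit_def)
          qed (use osuc \<xi>0 in \<open>auto simp: is_limit_def\<close>)
        qed
      qed
      ultimately show ?thesis by (rule large_antimono)
    next
      case (pow b)
      hence "a \<le> b" using less.prems by (simp add: omega_pow_le_iff)
      thus ?thesis using large_schreier_omega_pow[OF lam, of b] large_mono pow by blast
    next
      case limit
      show ?thesis
      proof (cases "\<exists>\<alpha>. omega_pow \<alpha> < \<xi> \<and> \<xi> < omega_pow (osuc \<alpha>)")
        case True
        then obtain \<alpha> where \<alpha>: "omega_pow \<alpha> < \<xi>" "\<xi> < omega_pow (osuc \<alpha>)" by blast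
        have "a < osuc \<alpha>" using less.prems \<alpha>(2) omega_pow_less_iff le_less_trans by blast
        hence "a \<le> \<alpha>" by (simp add: less_osuc_iff)
        hence "large a (ends_in (schreier lam (omega_pow \<alpha>)))"
          using large_schreier_omega_pow[OF lam, of \<alpha>] large_mono large_ends_in by blast
        moreover have "schreier lam \<xi> \<le> ends_in (schreier lam (omega_pow \<alpha>))"
        proof (rule le_funI)
          fix s
          show "schreier lam \<xi> s \<le> ends_in (schreier lam (omega_pow \<alpha>)) s"
          proof (rule le_boolI)
            assume "schreier lam \<xi> s"
            thus "ends_in (schreier lam (omega_pow \<alpha>)) s"
            proof (cases rule: schreier.cases)
              case (sum ts \<alpha>' p ts' ss)
              have "\<alpha>' < osuc \<alpha>" "\<alpha> < osuc \<alpha>'"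
                using \<alpha> sum omega_pow_less_iff less_trans by blast+
              hence "\<alpha>' = \<alpha>" by (simp add: less_osuc_iff)
              \<comment> \<open>The list runs from right to left, so its head is the rightmost block
                and all others join the earlier part.\<close>
              obtain s0 ss' where ss: "ss = s0 # ss'" using sum by (cases ss) auto
              have "union_of_successive p (schreier lam (omega_pow \<alpha>)) s0" "0 < p"
                using sum ss \<open>\<alpha>' = \<alpha>\<close> by force+
              hence "ends_in (schreier lam (omega_pow \<alpha>)) s0" by (rule union_of_successive_ends_in)
              then obtain A B where AB: "before A B" "schreier lam (omega_pow \<alpha>) B" "s0 = A \<union> B"
                by (auto simp: ends_in_def)
              have "before (\<Union>(set ss') \<union> A) B" using AB ss \<open>sorted_wrt (\<lambda>x y. before y x) ss\<close>
                by (auto simp: before_def)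
              moreover have "s = (\<Union>(set ss') \<union> A) \<union> B" using sum ss AB by auto
              ultimately show ?thesis using AB(2) unfolding ends_in_def by blast
            qed (use limit \<xi>0 in \<open>auto simp: is_limit_def one_omega1_def\<close>)
          qed
        qed
        ultimately show ?thesis by (rule large_antimono)
      next
        case False
        \<comment> \<open>Without such an exponent no clause applies: the family is empty, and any
          rank bound holds for it.\<close>
        have "\<not> schreier lam \<xi> s" for s
        proof
          assume "schreier lam \<xi> s"
          thus False
          proof (cases rule: schreier.cases)
            case sum
            thus False using False by blast
          qed (use limit \<xi>0 in \<open>auto simp: is_limit_def one_omega1_def\<close>)
        qed
        thus ?thesis by (intro large_antimono[OF large_none]) auto
      qed
    qed
  qed
qed

context located_words
begin

section \<open>Accepting and rejecting\<close>

definition min_set :: "'a word list \<Rightarrow> nat set" where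
  "min_set s = (\<lambda>x. Min (dom x)) ` set s"

text \<open>The tree of extensions of \<open>s\<close> by words of \<open>E\<close> that avoid
  \<open>G\<close> has rank at most \<open>\<sigma>\<close>.\<close>

inductive rank_le :: "'a word set \<Rightarrow> ('a word list \<Rightarrow> bool) \<Rightarrow> omega1 \<Rightarrow> 'a word list \<Rightarrow> bool"
  for E G where
  rank_base: "G s \<Longrightarrow> rank_le E G \<sigma> s"
| rank_step: "(\<And>x. x \<in> E \<Longrightarrow> after s x \<Longrightarrow> \<exists>\<tau><\<sigma>. rank_le E G \<tau> (s @ [x])) \<Longrightarrow> rank_le E G \<sigma> s"

text \<open>Countably many children have ranks with a common countable bound, so a node without rank
  has a child without rank. Starting at the root, this would give an infinite branch that never
  enters \<open>G\<close>.\<close>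

lemma rank_exists:
  assumes "countable E" "E \<subseteq> words"
    and bar: "\<And>v. v \<in> seqs \<Longrightarrow> (\<And>i. v i \<in> E) \<Longrightarrow> \<exists>n. G (map v [0..<n])"
  shows "\<exists>\<sigma>. rank_le E G \<sigma> []"
proof (rule ccontr)
  assume contra: "\<not> ?thesis"
  define R where "R s \<longleftrightarrow> (\<exists>\<sigma>. rank_le E G \<sigma> s)" for s
  have child: "\<exists>x\<in>E. after s x \<and> \<not> R (s @ [x])" if "\<not> R s" for s
  proof (rule ccontr)
    assume "\<not> ?thesis"
    hence "\<forall>x. \<exists>\<tau>. x \<in> E \<longrightarrow> after s x \<longrightarrow> rank_le E G \<tau> (s @ [x])" unfolding R_def by blast
    then obtain \<tau> where \<tau>: "\<And>x. x \<in> E \<Longrightarrow> after s x \<Longrightarrow> rank_le E G (\<tau> x) (s @ [x])" by metis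
    obtain \<sigma> where "\<forall>a\<in>\<tau> ` E. a < \<sigma>"
      using countable_omega1_bounded[of "\<tau> ` E"] assms(1) by auto
    hence "rank_le E G \<sigma> s" using \<tau> by (intro rank_step) blast
    thus False using that by (auto simp: R_def)
  qed
  have "\<exists>f. \<forall>n. (length (f n) = n \<and> \<not> R (f n)) \<and>
      (\<exists>x\<in>E. after (f n) x \<and> f (Suc n) = f n @ [x])"
  proof (rule dependent_nat_choice)
    show "\<exists>s. length s = 0 \<and> \<not> R s" using contra by (auto simp: R_def)
    fix s n assume s: "length s = n \<and> \<not> R s"
    then obtain x where "x \<in> E" "after s x" "\<not> R (s @ [x])" using child[of s] by blast
    thus "\<exists>s'. (length s' = Suc n \<and> \<not> R s') \<and> (\<exists>x\<in>E. after s x \<and> s' = s @ [x])"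
      using s by (intro exI[of _ "s @ [x]"]) auto
  qed
  then obtain f where f: "\<And>n. length (f n) = n" "\<And>n. \<not> R (f n)"
    "\<And>n. \<exists>x\<in>E. after (f n) x \<and> f (Suc n) = f n @ [x]" by blast
  then obtain v where v: "\<And>n. v n \<in> E" "\<And>n. after (f n) (v n)" "\<And>n. f (Suc n) = f n @ [v n]"
    by metis
  have fv: "f n = map v [0..<n]" for n
    by (induction n) (use f(1)[of 0] v(3) in auto)
  have "word_less (v n) (v (Suc n))" for n
    using v(2)[of "Suc n"] by (simp add: after_def v(3))
  hence "v \<in> seqs" using v(1) assms(2) by (auto simp: Linf_def)
  then obtain n where "G (map v [0..<n])" using bar v(1) by blast
  hence "R (f n)" using rank_base by (auto simp: R_def fv)
  thus False using f(2) by blast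
qed

lemma countable_ev: "countable (ev v)"
proof -
  have "ev v \<subseteq> (\<lambda>ips. foldr (++) (map (\<lambda>(i, p). subst p (v i)) ips) Map.empty) ` UNIV"
    unfolding EV_def by blast
  thus ?thesis by (rule countable_subset) simp
qed

text \<open>Induction on the rank. A first word \<open>x\<close> with large minimum \<open>n\<close>
  leads to a child of rank below \<open>\<sigma>\<close> and replaces \<open>H\<close> by
  \<open>link H n\<close>, which is large for \<open>\<sigma>\<close>; largeness stays ahead of the
  rank, so a sequence cannot reach \<open>H\<close> before \<open>G\<close>. Fusion finds one
  \<open>v'\<close> for all first words.\<close>

lemma evfin_avoiding_large:
  assumes u: "u \<in> seqs" and G: "\<And>s x. G s \<Longrightarrow> x \<in> ev u \<Longrightarrow> G (s @ [x])"
  shows "rank_le (ev u) G \<sigma> s \<Longrightarrow> v \<preceq> u \<Longrightarrow> large \<rho> H \<Longrightarrow> \<sigma> < \<rho> \<Longrightarrow>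
    \<exists>v'. v' \<preceq> v \<and> (\<forall>s'\<in>evfin v'. H (min_set s') \<longrightarrow> G (s @ s'))"
proof (induction arbitrary: v \<rho> H rule: rank_le.induct)
  case (rank_base s \<sigma>)
  have "G (s @ s')" if "set s' \<subseteq> ev u" for s'
    using that
  proof (induction s' rule: rev_induct)
    case (snoc x s')
    thus ?case using G[of "s @ s'" x] by simp
  qed (use rank_base in simp)
  moreover have "set s' \<subseteq> ev u" if "s' \<in> evfin v" for s'
    using that prec_ev_mono[OF rank_base(2) u] by (auto simp: EVfin_def)
  ultimately show ?case using prec_refl[OF prec_seqs[OF rank_base(2)]] by blast
next
  case (rank_step s \<sigma>)
  have v: "v \<in> seqs" using rank_step.prems(1) prec_seqs by blast
  have H0: "\<not> H {}" and "\<exists>N. \<forall>n\<ge>N. large \<sigma> (link H n)"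
    using rank_step.prems(2,3) large_iff[of \<rho> H] by blast+
  then obtain N where N: "\<And>n. n \<ge> N \<Longrightarrow> large \<sigma> (link H n)" by blast
  \<comment> \<open>Dropping \<open>M\<close> terms moves all positions beyond \<open>M\<close>:
    every first word then has minimum above \<open>N\<close> and comes after
    \<open>s\<close>.\<close>
  define M where "M = max N (Max (dom (last s)))"
  \<comment> \<open>Only one-word sequences carry a condition. That \<open>s''\<close> follows
    \<open>x\<close> is demanded explicitly, so that \<open>D\<close> depends only on words after
    \<open>[x]\<close>, as fusion requires.\<close>
  define D where "D s' v \<longleftrightarrow> (\<forall>x. s' = [x] \<longrightarrow> x \<in> ev u \<longrightarrow> after s x \<longrightarrow> N \<le> Min (dom x) \<longrightarrow>
    (\<forall>s''\<in>evfin v. (\<forall>y\<in>set s''. word_less x y) \<longrightarrow> H (min_set (x # s'')) \<longrightarrow> G (s @ x # s'')))"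
    for s' v
  have "\<exists>v'. v' \<preceq> v \<circ> (+) M \<and> (\<forall>s\<in>evfin v'. D s v')"
  proof (rule fusion[OF seqs_shift[OF v]])
    fix s' v1 assume s': "s' \<in> Lfin \<alpha> \<upsilon> k" and v1: "v1 \<preceq> v \<circ> (+) M"
    have v1u: "v1 \<preceq> u"
      using prec_trans[OF v1 prec_le_shift[OF rank_step.prems(1) u] u] .
    show "\<exists>v'. v' \<preceq> v1 \<and> D s' v'"
    proof (cases "\<exists>x. s' = [x] \<and> x \<in> ev u \<and> after s x \<and> N \<le> Min (dom x)")
      case True
      then obtain x where x: "s' = [x]" "x \<in> ev u" "after s x" "N \<le> Min (dom x)" by blast
      obtain \<tau> where "\<tau> < \<sigma>" and IH: "\<And>v \<rho> H. v \<preceq> u \<Longrightarrow> large \<rho> H \<Longrightarrow> \<tau> < \<rho> \<Longrightarrow>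
          \<exists>v'. v' \<preceq> v \<and> (\<forall>s'\<in>evfin v'. H (min_set s') \<longrightarrow> G ((s @ [x]) @ s'))"
        using rank_step.IH[OF x(2,3)] by blast
      then obtain v' where v': "v' \<preceq> v1"
        "\<And>s''. s'' \<in> evfin v' \<Longrightarrow> link H (Min (dom x)) (min_set s'') \<Longrightarrow> G ((s @ [x]) @ s'')"
        using IH[OF v1u N[OF x(4)]] by blast
      have "D s' v'"
        unfolding D_def
      proof (intro allI impI ballI)
        fix x' s''
        assume *: "s' = [x']" "s'' \<in> evfin v'" "\<forall>y\<in>set s''. word_less x' y" "H (min_set (x' # s''))"
        hence "x' = x" using x by simp
        have "Min (dom x) < Min (dom y)" if "y \<in> set s''" for y
        proof -
          have "x \<in> words" using ev_words[OF u x(2)] .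
          hence "Min (dom x) \<le> Max (dom x)" using words_dom[of x] by (intro Max_ge Min_in)
          thus ?thesis using * \<open>x' = x\<close> that by (auto simp: word_less_def intro: le_less_trans)
        qed
        hence "link H (Min (dom x)) (min_set s'')"
          using * \<open>x' = x\<close> by (auto simp: link_def before_def min_set_def)
        thus "G (s @ x' # s'')" using v'(2)[OF *(2)] \<open>x' = x\<close> by simp
      qed
      thus ?thesis using v'(1) by blast
    next
      case False
      thus ?thesis using prec_refl[OF prec_seqs[OF v1]] by (auto simp: D_def)
    qed
  next
    fix s' v1 v2
    assume D: "D s' v1" and sub: "\<And>x. x \<in> ev v2 \<Longrightarrow> after s' x \<Longrightarrow> x \<in> ev v1"
    show "D s' v2"
      unfolding D_def
    proof (intro allI impI ballI)
      fix x s''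
      assume x: "s' = [x]" "x \<in> ev u" "after s x" "N \<le> Min (dom x)" and
        s'': "s'' \<in> evfin v2" "\<forall>y\<in>set s''. word_less x y" "H (min_set (x # s''))"
      hence "s'' \<in> evfin v1" using sub by (auto simp: EVfin_def after_def)
      thus "G (s @ x # s'')" using D x s'' by (simp add: D_def)
    qed
  qed
  then obtain v' where v': "v' \<preceq> v \<circ> (+) M" "\<And>s. s \<in> evfin v' \<Longrightarrow> D s v'" by blast
  have v'v: "v' \<preceq> v" using prec_trans[OF v'(1) prec_shift[OF v] v] .
  have "G (s @ s')" if s': "s' \<in> evfin v'" "H (min_set s')" for s'
  proof (cases s')
    case Nil
    thus ?thesis using s' H0 by (simp add: min_set_def)
  next
    case (Cons x s'')
    have x: "x \<in> words" "x \<in> ev v'" "s'' \<in> evfin v'" "\<forall>y\<in>set s''. word_less x y"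
      using s'(1) unfolding Cons evfin_Cons by blast+
    have "M < n" if "n \<in> dom x" for n
    proof -
      have "x \<in> ev (v \<circ> (+) M)" using prec_ev_mono[OF v'(1) seqs_shift[OF v]] x(2) by blast
      hence "comb (v \<circ> (+) M) UNIV True x" by (simp add: ev_iff)
      from comb_dom[OF this that] obtain i where "n \<in> dom ((v \<circ> (+) M) i)" by blast
      thus ?thesis using seqs_dom_ge[OF v, of n "M + i"] by simp
    qed
    hence "M < Min (dom x)" using words_dom[OF x(1)] by (simp add: Min_gr_iff)
    hence "N \<le> Min (dom x)" "after s x" by (auto simp: M_def after_def word_less_def)
    moreover have "x \<in> ev u"
      using x(2) prec_ev_mono[OF prec_trans[OF v'v rank_step.prems(1) u] u] by blast
    moreover have "[x] \<in> evfin v'" using x by (simp add: evfin_Cons) (simp add: EVfin_def Lfin_def)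
    ultimately show ?thesis using v'(2)[of "[x]"] x s'(2) unfolding D_def Cons by blast
  qed
  thus ?case using v'v by blast
qed

section \<open>Basic sets and neighbourhoods\<close>

lemma seq_minus_init_seg:
  assumes "z \<in> seqs" "init_seg t z"
  shows "seq_minus z t = z \<circ> (+) (length t)"
proof (cases t rule: rev_cases)
  case (snoc t' x)
  have x: "x = z (length t')" using assms(2) by (auto simp: init_seg_def snoc nth_append)
  have less: "word_less (last t) (z l) \<longleftrightarrow> length t' < l" for l
    using seqs_less_iff[OF assms(1)] by (simp add: snoc x word_less_iff seqs_words[OF assms(1)])
  have "(LEAST l. length t' < l) = Suc (length t')" by (rule Least_equality) auto
  thus ?thesis unfolding seq_minus_def less by (auto simp: snoc)
qed (simp add: seq_minus_def fun_eq_iff)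

text \<open>Subtracting an initial segment is a plain shift. As \<open>z\<close> is in
  \<open>seqs\<close>, the basic set is empty whenever \<open>t\<close> is not increasing.\<close>

lemma basic_iff:
  "z \<in> basic \<alpha> \<upsilon> k t s \<longleftrightarrow> z \<in> seqs \<and> init_seg t z \<and> (\<forall>i\<ge>length t. z i \<in> ev s)"
proof -
  have "prec \<alpha> \<upsilon> k (z \<circ> (+) n) s \<longleftrightarrow> (\<forall>i\<ge>n. z i \<in> ev s)" if "z \<in> seqs" for n
    using seqs_shift[OF that] by (auto simp: prec_def dest: le_Suc_ex)
  thus ?thesis by (auto simp: basic_def seq_minus_init_seg)
qed

lemma basic_mono: "u \<preceq> v \<Longrightarrow> v \<in> seqs \<Longrightarrow> basic \<alpha> \<upsilon> k t u \<subseteq> basic \<alpha> \<upsilon> k t v"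
  using prec_ev_mono[of u v] by (simp add: basic_iff subset_iff)

lemma basic_snoc:
  assumes "x \<in> ev v"
  shows "basic \<alpha> \<upsilon> k (t @ [x]) v \<subseteq> basic \<alpha> \<upsilon> k t v"
proof
  fix z assume z: "z \<in> basic \<alpha> \<upsilon> k (t @ [x]) v"
  hence init: "(t @ [x]) ! i = z i" if "i \<le> length t" for i
    using that by (simp add: basic_iff init_seg_def)
  have "z (length t) = x" using init[of "length t"] by simp
  moreover have "init_seg t z"
    unfolding init_seg_def
  proof (intro allI impI)
    fix i assume "i < length t"
    thus "t ! i = z i" using init[of i] by (simp add: nth_append)
  qed
  moreover have "z i \<in> ev v" if "length t \<le> i" "i \<noteq> length t" for i
    using z that by (auto simp: basic_iff)
  ultimately show "z \<in> basic \<alpha> \<upsilon> k t v" using z assms by (auto simp: basic_iff)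
qed

lemma seq_minus_props:
  assumes w: "w \<in> seqs"
  shows "seq_minus w t \<in> seqs" "seq_minus w t \<preceq> w"
proof -
  have "\<exists>n. seq_minus w t = w \<circ> (+) n"
  proof (cases "t = []")
    case True
    thus ?thesis by (intro exI[of _ 0]) (simp add: seq_minus_def fun_eq_iff)
  qed (auto simp: seq_minus_def fun_eq_iff)
  thus "seq_minus w t \<preceq> w" using prec_shift[OF w] by auto
  thus "seq_minus w t \<in> seqs" by (rule prec_seqs)
qed

text \<open>The shift of \<open>y\<close> by \<open>n\<close> is needed: over \<open>y\<close> itself, the larger indices would admit more
  substitution parameters than \<open>s\<close> does.\<close>

lemma TE_nhds:
  assumes "openin (TE \<alpha> \<upsilon> k) O'" "y \<in> O'" "y \<in> seqs"
  shows "\<exists>n0. \<forall>n\<ge>n0. basic \<alpha> \<upsilon> k (map y [0..<n]) (y \<circ> (+) n) \<subseteq> O'"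
proof -
  have "generate_topology_on {basic \<alpha> \<upsilon> k t s | t s. t \<in> Lfin \<alpha> \<upsilon> k \<and> s \<in> seqs} O'"
    using assms(1) by (simp add: TE_def openin_topology_generated_by_iff)
  thus ?thesis using assms(2)
  proof (induction rule: generate_topology_on.induct)
    case (Int a b)
    then obtain m n where "\<forall>i\<ge>m. basic \<alpha> \<upsilon> k (map y [0..<i]) (y \<circ> (+) i) \<subseteq> a"
      "\<forall>i\<ge>n. basic \<alpha> \<upsilon> k (map y [0..<i]) (y \<circ> (+) i) \<subseteq> b" by blast
    thus ?case by (intro exI[of _ "max m n"]) (metis Int_greatest max.bounded_iff)
  next
    case (UN K)
    thus ?case by blast
  next
    case (Basis B)
    then obtain t s where B: "B = basic \<alpha> \<upsilon> k t s" "s \<in> seqs" by blast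
    have y: "init_seg t y" "\<And>i. length t \<le> i \<Longrightarrow> y i \<in> ev s"
      using Basis.prems B by (auto simp: basic_iff)
    have "z \<in> B" if n: "length t \<le> n" and z: "z \<in> basic \<alpha> \<upsilon> k (map y [0..<n]) (y \<circ> (+) n)" for n z
    proof -
      have zy: "z i = y i" if "i < n" for i using z that by (auto simp: basic_iff init_seg_def)
      have "y \<circ> (+) n \<preceq> s" using seqs_shift[OF assms(3)] y(2) n by (auto simp: prec_def)
      hence "ev (y \<circ> (+) n) \<subseteq> ev s" using B(2) by (rule prec_ev_mono)
      hence "z i \<in> ev s" if "n \<le> i" for i using z that by (auto simp: basic_iff)
      hence "z i \<in> ev s" if "length t \<le> i" for i
        using that zy y(2) by (cases "i < n") auto
      moreover have "init_seg t z" using y(1) zy n by (auto simp: init_seg_def)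
      ultimately show ?thesis using z by (auto simp: B basic_iff)
    qed
    thus ?case by blast
  qed auto
qed

lemma seqs_topspace: "seqs \<subseteq> topspace (TE \<alpha> \<upsilon> k)"
proof
  fix y assume y: "y \<in> seqs"
  hence "y \<in> basic \<alpha> \<upsilon> k [] y" by (simp add: basic_iff init_seg_def ev_self)
  moreover have "[] \<in> Lfin \<alpha> \<upsilon> k" by (simp add: Lfin_def)
  ultimately show "y \<in> topspace (TE \<alpha> \<upsilon> k)"
    using y by (auto simp: TE_def topology_generated_by_topspace)
qed

section \<open>Acceptance, rejection and the dichotomy\<close>

definition accepts ::
  "(nat \<Rightarrow> 'a word) set \<Rightarrow> 'a word list \<Rightarrow> (nat \<Rightarrow> 'a word) \<Rightarrow> 'a word list \<Rightarrow> bool" where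
  "accepts U t v s \<longleftrightarrow> (\<forall>x. x \<preceq> v \<longrightarrow> after s (x 0) \<longrightarrow>
     (\<exists>n. basic \<alpha> \<upsilon> k (t @ s @ map x [0..<n]) v \<inter> U = {}))"

definition rejects ::
  "(nat \<Rightarrow> 'a word) set \<Rightarrow> 'a word list \<Rightarrow> (nat \<Rightarrow> 'a word) \<Rightarrow> 'a word list \<Rightarrow> bool" where
  "rejects U t v s \<longleftrightarrow> (\<forall>v'. v' \<preceq> v \<longrightarrow> \<not> accepts U t v' s)"

lemma accepts_mono:
  assumes acc: "accepts U t v s" and v: "v' \<preceq> v" "v \<in> seqs"
  shows "accepts U t v' s"
  unfolding accepts_def
proof (intro allI impI)
  fix x assume x: "x \<preceq> v'" "after s (x 0)"
  then obtain n where n: "basic \<alpha> \<upsilon> k (t @ s @ map x [0..<n]) v \<inter> U = {}"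
    using acc prec_trans[OF x(1) v] unfolding accepts_def by blast
  thus "\<exists>n. basic \<alpha> \<upsilon> k (t @ s @ map x [0..<n]) v' \<inter> U = {}"
    using basic_mono[OF v, of "t @ s @ map x [0..<n]"] by blast
qed

text \<open>Acceptance sees only words after \<open>s\<close>: the branches start there, and so do
  the terms of members of the basic sets past their prefix.\<close>

lemma accepts_almost_mono:
  assumes acc: "accepts U t v s" and v: "v \<in> seqs" "v' \<in> seqs"
    and sub: "\<And>x. x \<in> ev v' \<Longrightarrow> after s x \<Longrightarrow> x \<in> ev v"
  shows "accepts U t v' s"
  unfolding accepts_def
proof (intro allI impI)
  fix x assume x: "x \<preceq> v'" "after s (x 0)"
  have "x i \<in> ev v" for i
    using x sub[of "x i"] after_seqs_mono[OF prec_seqs[OF x(1)] x(2), of i] by (auto simp: prec_def)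
  hence "x \<preceq> v" using prec_seqs[OF x(1)] by (simp add: prec_def)
  then obtain n where n: "basic \<alpha> \<upsilon> k (t @ s @ map x [0..<n]) v \<inter> U = {}"
    using acc x(2) by (auto simp: accepts_def)
  have "z i \<in> ev v" if z: "z \<in> basic \<alpha> \<upsilon> k (t @ s @ map x [0..<n]) v'"
    and i: "length (t @ s @ map x [0..<n]) \<le> i" for z i
  proof (rule sub)
    show "z i \<in> ev v'" using z i by (auto simp: basic_iff)
    have zs: "z \<in> seqs" using z by (simp add: basic_iff)
    show "after s (z i)"
    proof (cases s rule: rev_cases)
      case (snoc s' y)
      have "y = z (length t + length s')"
        using z unfolding basic_iff init_seg_def by (auto simp: snoc nth_append dest: spec[of _ "length t + length s'"])
      thus ?thesis using i seqs_less[OF zs] by (simp add: snoc after_def word_less_iff seqs_words[OF zs])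
    qed (simp add: after_def)
  qed
  hence "basic \<alpha> \<upsilon> k (t @ s @ map x [0..<n]) v' \<subseteq> basic \<alpha> \<upsilon> k (t @ s @ map x [0..<n]) v"
    by (auto simp: basic_iff)
  thus "\<exists>n. basic \<alpha> \<upsilon> k (t @ s @ map x [0..<n]) v' \<inter> U = {}" using n by blast
qed

text \<open>An accepting \<open>x \<preceq> v'\<close> need not be below \<open>v\<close>, but its
  tail past \<open>s\<close> is, and the tail inherits acceptance.\<close>

lemma rejects_almost_mono:
  assumes rej: "rejects U t v s" and v: "v \<in> seqs" "v' \<in> seqs"
    and sub: "\<And>x. x \<in> ev v' \<Longrightarrow> after s x \<Longrightarrow> x \<in> ev v"
  shows "rejects U t v' s"
  unfolding rejects_def
proof (intro allI impI notI)
  fix x assume x: "x \<preceq> v'" "accepts U t x s"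
  define n where "n = Max (dom (last s))"
  have xs: "x \<in> seqs" using x prec_seqs by blast
  have "x i \<in> ev v" if "n \<le> i" for i
    using after_eventually[OF xs, of s i] that sub[of "x i"] x(1) by (auto simp: prec_def n_def)
  hence "x \<circ> (+) n \<preceq> v" using seqs_shift[OF xs] by (auto simp: prec_def)
  moreover have "accepts U t (x \<circ> (+) n) s"
    using accepts_mono[OF x(2) prec_shift[OF xs] xs] .
  ultimately show False using rej by (auto simp: rejects_def)
qed

lemma deciding:
  assumes w: "w \<in> seqs"
  shows "\<exists>u. u \<preceq> w \<and> (\<forall>s\<in>evfin u. accepts U t u s \<or> rejects U t u s)"
proof (rule fusion[OF w])
  fix s v assume "v \<preceq> w"
  thus "\<exists>v'. v' \<preceq> v \<and> (accepts U t v' s \<or> rejects U t v' s)"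
    using prec_refl[OF prec_seqs, of v] unfolding rejects_def[of U t v] rejects_def by blast
next
  fix s v v'
  assume v: "v \<preceq> w" "v' \<preceq> w" and "accepts U t v s \<or> rejects U t v s"
    "\<And>x. x \<in> ev v' \<Longrightarrow> after s x \<Longrightarrow> x \<in> ev v"
  thus "accepts U t v' s \<or> rejects U t v' s"
    using accepts_almost_mono rejects_almost_mono prec_seqs[OF v(1)] prec_seqs[OF v(2)] by metis
qed

text \<open>Words \<open>x\<close> are coloured by whether \<open>u\<close> accepts
  \<open>s @ [x]\<close>. Were all extensions accepted, their bars would combine to a bar for
  \<open>s\<close>, against rejection; in the other colour each extension is unaccepted, hence
  rejected since \<open>u\<close> decides it.\<close>

lemma rejects_step:
  assumes u: "u \<in> seqs" and v: "v \<preceq> u" and rej: "rejects U t u s" and s: "s \<in> evfin u"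
    and dec: "\<And>s. s \<in> evfin u \<Longrightarrow> accepts U t u s \<or> rejects U t u s"
  shows "\<exists>v'. v' \<preceq> v \<and> (\<forall>x\<in>ev v'. after s x \<longrightarrow> rejects U t u (s @ [x]))"
proof -
  have vs: "v \<in> seqs" using v prec_seqs by blast
  obtain v' where v': "v' \<preceq> v" and or: "(\<forall>x\<in>ev v'. after s x \<longrightarrow> accepts U t u (s @ [x])) \<or>
      (\<forall>x\<in>ev v'. \<not> (after s x \<longrightarrow> accepts U t u (s @ [x])))"
    using pigeonhole[OF vs, of "\<lambda>x. after s x \<longrightarrow> accepts U t u (s @ [x])"] by blast
  have v'u: "v' \<preceq> u" using prec_trans[OF v' v u] .
  from or show ?thesis
  proof
    assume acc: "\<forall>x\<in>ev v'. after s x \<longrightarrow> accepts U t u (s @ [x])"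
    have "accepts U t v' s"
      unfolding accepts_def
    proof (intro allI impI)
      fix y assume y: "y \<preceq> v'" "after s (y 0)"
      hence ys: "y \<in> seqs" and "y 0 \<in> ev v'" by (auto simp: prec_def)
      hence "accepts U t u (s @ [y 0])" using acc y by blast
      moreover have "y \<circ> (+) 1 \<preceq> u" using prec_trans[OF prec_le_shift[OF y(1)] v'u u] v'u prec_seqs by blast
      moreover have "after (s @ [y 0]) ((y \<circ> (+) 1) 0)"
        using ys by (simp add: after_def Linf_def)
      ultimately obtain n where "basic \<alpha> \<upsilon> k (t @ (s @ [y 0]) @ map (y \<circ> (+) 1) [0..<n]) u \<inter> U = {}"
        unfolding accepts_def by blast
      \<comment> \<open>Depth \<open>n\<close> along the shifted branch is depth
        \<open>Suc n\<close> along \<open>y\<close>.\<close>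
      moreover have "(s @ [y 0]) @ map (y \<circ> (+) 1) [0..<n] = s @ map y [0..<Suc n]"
        by (simp add: map_upt_Suc comp_def del: upt_Suc)
      ultimately have "basic \<alpha> \<upsilon> k (t @ s @ map y [0..<Suc n]) u \<inter> U = {}" by simp
      thus "\<exists>n. basic \<alpha> \<upsilon> k (t @ s @ map y [0..<n]) v' \<inter> U = {}"
        using basic_mono[OF v'u u] by blast
    qed
    thus ?thesis using rej v'u by (auto simp: rejects_def)
  next
    assume "\<forall>x\<in>ev v'. \<not> (after s x \<longrightarrow> accepts U t u (s @ [x]))"
    moreover have "s @ [x] \<in> evfin u" if "x \<in> ev v'" "after s x" for x
      using that s prec_ev_mono[OF v'u u] by (auto simp: evfin_snoc[OF u])
    ultimately show ?thesis using v' dec by blast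
  qed
qed

text \<open>Rejection stays relative to \<open>u\<close> while the words come from \<open>v\<close>,
  so the induction along \<open>s\<close> can pass it from each sequence to its extensions.\<close>

lemma all_rejecting:
  assumes u: "u \<in> seqs" and rej: "rejects U t u []"
    and dec: "\<And>s. s \<in> evfin u \<Longrightarrow> accepts U t u s \<or> rejects U t u s"
  shows "\<exists>v. v \<preceq> u \<and> (\<forall>s\<in>evfin v. rejects U t u s)"
proof -
  define D where "D s v \<longleftrightarrow> (s \<in> evfin u \<longrightarrow> rejects U t u s \<longrightarrow>
    (\<forall>x\<in>ev v. after s x \<longrightarrow> rejects U t u (s @ [x])))" for s v
  have "\<exists>v. v \<preceq> u \<and> (\<forall>s\<in>evfin v. D s v)"
  proof (rule fusion[OF u])
    fix s v assume v: "v \<preceq> u"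
    show "\<exists>v'. v' \<preceq> v \<and> D s v'"
    proof (cases "s \<in> evfin u \<and> rejects U t u s")
      case True
      thus ?thesis using rejects_step[OF u v _ _ dec] by (auto simp: D_def)
    next
      case False
      thus ?thesis using prec_refl[OF prec_seqs[OF v]] by (auto simp: D_def)
    qed
  qed (auto simp: D_def)
  then obtain v where v: "v \<preceq> u" "\<And>s. s \<in> evfin v \<Longrightarrow> D s v" by blast
  have vs: "v \<in> seqs" using v prec_seqs by blast
  have "rejects U t u s" if "s \<in> evfin v" for s
    using that
  proof (induction s rule: rev_induct)
    case (snoc x s)
    hence s: "s \<in> evfin v" "x \<in> ev v" "after s x" by (auto simp: evfin_snoc[OF vs])
    moreover have "s \<in> evfin u" using s(1) evfin_mono[OF v(1) u] by blast
    ultimately show ?case using v(2)[OF s(1)] snoc.IH by (auto simp: D_def)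
  qed (rule rej)
  thus ?thesis using v(1) by blast
qed

lemma all_rejecting_closure:
  assumes u: "u \<in> seqs" and v: "v \<preceq> u" and rej: "\<And>s. s \<in> evfin v \<Longrightarrow> rejects U t u s"
  shows "basic \<alpha> \<upsilon> k t v \<subseteq> TE \<alpha> \<upsilon> k closure_of U"
proof
  fix y assume y: "y \<in> basic \<alpha> \<upsilon> k t v"
  hence ys: "y \<in> seqs" and t: "init_seg t y" and yv: "\<And>i. length t \<le> i \<Longrightarrow> y i \<in> ev v"
    by (auto simp: basic_iff)
  have "\<exists>z\<in>U. z \<in> O'" if O': "y \<in> O'" "openin (TE \<alpha> \<upsilon> k) O'" for O'
  proof -
    obtain n0 where n0: "\<And>n. n \<ge> n0 \<Longrightarrow> basic \<alpha> \<upsilon> k (map y [0..<n]) (y \<circ> (+) n) \<subseteq> O'"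
      using TE_nhds[OF O'(2,1) ys] by blast
    define n where "n = max n0 (length t)"
    define s where "s = map y [length t..<n]"
    have "t = map y [0..<length t]" using t by (auto simp: init_seg_def intro!: nth_equalityI)
    hence ts: "map y [0..<n] = t @ s"
      unfolding s_def n_def by (metis le_add_diff_inverse map_append max.cobounded2 upt_add_eq_append zero_le)
    have vs: "v \<in> seqs" using v prec_seqs by blast
    have "s \<in> evfin v" unfolding s_def by (rule evfin_map[OF vs ys yv])
    hence "rejects U t u s" by (rule rej)
    \<comment> \<open>This tail is the test sequence because the neighbourhood of \<open>y\<close>
      is a basic set over it.\<close>
    moreover have "y \<circ> (+) n \<preceq> u"
    proof (rule prec_trans[OF _ v u])
      show "y \<circ> (+) n \<preceq> v" using seqs_shift[OF ys] yv by (auto simp: prec_def n_def)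
    qed
    ultimately have "\<not> accepts U t (y \<circ> (+) n) s" by (simp add: rejects_def)
    \<comment> \<open>Along the branch \<open>x\<close> every basic set meets \<open>U\<close>;
      depth \<open>0\<close> gives the prefix \<open>t @ s\<close> itself.\<close>
    then obtain x where "basic \<alpha> \<upsilon> k (t @ s @ map x [0..<m]) (y \<circ> (+) n) \<inter> U \<noteq> {}" for m
      unfolding accepts_def by blast
    from this[of 0] have "basic \<alpha> \<upsilon> k (map y [0..<n]) (y \<circ> (+) n) \<inter> U \<noteq> {}" by (simp add: ts)
    thus ?thesis using n0[of n] by (auto simp: n_def)
  qed
  thus "y \<in> TE \<alpha> \<upsilon> k closure_of U" using seqs_topspace ys by (auto simp: in_closure_of)
qed

lemma dichotomy:
  assumes lam: "fundamental_sequences lam" and w: "w \<in> seqs"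
  shows "(\<exists>u. u \<preceq> w \<and> basic \<alpha> \<upsilon> k t u \<subseteq> TE \<alpha> \<upsilon> k closure_of U) \<or>
    (\<exists>\<xi>0. \<forall>\<xi>>\<xi>0. \<exists>u. u \<preceq> w \<and>
       (\<forall>s \<in> Lxi lam \<alpha> \<upsilon> k \<xi> \<inter> evfin u. basic \<alpha> \<upsilon> k (t @ s) u \<subseteq> seqs - U))"
proof -
  obtain u where uw: "u \<preceq> w" and dec: "\<And>s. s \<in> evfin u \<Longrightarrow> accepts U t u s \<or> rejects U t u s"
    using deciding[OF w] by blast
  have u: "u \<in> seqs" using uw prec_seqs by blast
  have "[] \<in> evfin u" by (simp add: EVfin_def Lfin_def)
  from dec[OF this] show ?thesis
  proof
    assume "rejects U t u []"
    then obtain v where v: "v \<preceq> u" "\<forall>s\<in>evfin v. rejects U t u s"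
      using all_rejecting[OF u _ dec] by blast
    hence "basic \<alpha> \<upsilon> k t v \<subseteq> TE \<alpha> \<upsilon> k closure_of U"
      using all_rejecting_closure[OF u v(1)] by blast
    thus ?thesis using prec_trans[OF v(1) uw w] by blast
  next
    assume acc: "accepts U t u []"
    define G where "G s \<longleftrightarrow> basic \<alpha> \<upsilon> k (t @ s) u \<inter> U = {}" for s
    have G: "G (s @ [x])" if "G s" "x \<in> ev u" for s x
      using that basic_snoc[of x u "t @ s"] by (auto simp: G_def)
    \<comment> \<open>For the empty sequence, acceptance is exactly the statement that
      \<open>G\<close> bars every branch through \<open>ev u\<close>.\<close>
    have "\<exists>n. G (map v [0..<n])" if "v \<in> seqs" "\<And>i. v i \<in> ev u" for v
      using acc that by (auto simp: accepts_def G_def prec_def after_def)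
    then obtain \<sigma> where \<sigma>: "rank_le (ev u) G \<sigma> []"
      using rank_exists[OF countable_ev, of u G] ev_words[OF u] by blast
    show ?thesis
    \<comment> \<open>The successor makes largeness exceed the rank strictly; the power is the price
      of \<open>large_schreier\<close>, which gives largeness \<open>a\<close> from
      \<open>omega_pow a\<close> on.\<close>
    proof (intro disjI2 exI[of _ "omega_pow (osuc \<sigma>)"] allI impI)
      fix \<xi> assume \<xi>: "\<xi> > omega_pow (osuc \<sigma>)"
      hence large: "large (osuc \<sigma>) (schreier lam \<xi>)" by (intro large_schreier[OF lam]) simp
      obtain v where v: "v \<preceq> u" "\<And>s. s \<in> evfin v \<Longrightarrow> schreier lam \<xi> (min_set s) \<Longrightarrow> G s"
        using evfin_avoiding_large[OF u G \<sigma> prec_refl[OF u] large less_osuc] by auto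
      have "basic \<alpha> \<upsilon> k (t @ s) v \<subseteq> seqs - U" if "s \<in> Lxi lam \<alpha> \<upsilon> k \<xi> \<inter> evfin v" for s
      proof -
        have "\<xi> \<noteq> 0" using \<xi> omega1_0_le[of "omega_pow (osuc \<sigma>)"] by auto
        hence "schreier lam \<xi> (min_set s)" using that by (simp add: Lxi_def min_set_def)
        hence "G s" using v(2) that by blast
        thus ?thesis using basic_mono[OF v(1) u, of "t @ s"] by (auto simp: G_def basic_iff)
      qed
      thus "\<exists>u. u \<preceq> w \<and> (\<forall>s\<in>Lxi lam \<alpha> \<upsilon> k \<xi> \<inter> evfin u. basic \<alpha> \<upsilon> k (t @ s) u \<subseteq> seqs - U)"
        using prec_trans[OF v(1) uw w] by blast
    qed
  qed
qed

end

theorem theorem4p2: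
  fixes \<alpha> :: "nat \<Rightarrow> 'a" and \<upsilon> :: 'a and k :: "nat \<Rightarrow> nat"
    and lam :: "omega1 \<Rightarrow> nat \<Rightarrow> omega1"
    and U :: "(nat \<Rightarrow> 'a word) set" and t :: "'a word list" and w :: "nat \<Rightarrow> 'a word"
  assumes "inj_on \<alpha> {1..}" and "\<upsilon> \<notin> \<alpha> ` {1..}"
    and "\<And>n. 1 \<le> n \<Longrightarrow> 1 \<le> k n" and "mono_on {1..} k"
    and "fundamental_sequences lam"
    and "U \<subseteq> Linf \<alpha> \<upsilon> k" and "t \<in> Lfin \<alpha> \<upsilon> k" and "w \<in> Linf \<alpha> \<upsilon> k"
  shows "(\<exists>u. prec \<alpha> \<upsilon> k u w \<and> basic \<alpha> \<upsilon> k t u \<subseteq> TE \<alpha> \<upsilon> k closure_of U) \<or>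
    (\<exists>\<xi>0. \<forall>\<xi>>\<xi>0. \<exists>u. prec \<alpha> \<upsilon> k u (seq_minus w t) \<and>
       (\<forall>s \<in> Lxi lam \<alpha> \<upsilon> k \<xi> \<inter> EVfin \<alpha> \<upsilon> k u.
          basic \<alpha> \<upsilon> k (t @ s) u \<subseteq> Linf \<alpha> \<upsilon> k - U))"
proof -
  interpret located_words \<alpha> \<upsilon> k
    using assms(2-4) by unfold_locales
  \<comment> \<open>The dichotomy is applied to \<open>seq_minus w t\<close>, with \<open>t\<close>
    kept as the prefix of the basic sets; in the first alternative transitivity leads back to
    \<open>w\<close>.\<close>
  show ?thesis
    using dichotomy[OF assms(5) seq_minus_props(1)[OF assms(8)], where t = t and U = U]
      prec_trans[OF _ seq_minus_props(2)[OF assms(8)] assms(8)] by blast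
qed

end
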